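(* Let $\mathbb{T}$ be a time scale with $\sup\mathbb{T}=\infty$, $t_0\in\mathbb{T}$, let $A:[t_0,\infty)_{\mathbb{T}}\to[0,\infty)$ and $\alpha:[t_0,\infty)_{\mathbb{T}}\to\mathbb{T}$ be rd-continuous with $\lim_{t\to\infty}\alpha(t)=\infty$, and consider the delay dynamic equation $$x^{\Delta}(t)+A(t)x(\alpha(t))=0,\qquad t\in[t_0,\infty)_{\mathbb{T}}. \quad (E)$$ Assume that $\alpha(t)\le t$ for all $t\in[t_0,\infty)_{\mathbb{T}}$, and that $$\sup_{s\in[t_0,\infty)_{\mathbb{T}}}\int_s^{\alpha_{-1}(s)}A(\eta)\,\Delta\eta<\infty ,\qquad \sup_{s\in[t_0,\infty)_{\mathbb{T}}}\{\alpha_{-1}(s)-s\}<\infty,\qquad \sup_{t\in[t_0,\infty)_{\mathbb{T}}}\int_{\alpha_*(t)}^{\sigma(t)}A(\eta)\,\Delta\eta<1 .$$ Let $\lambda_0\in(0,1)$ be such that $$\int_{\alpha_*(t)}^{\sigma(t)}\mathrm{e}_{\lambda_0A}(t,\alpha_*(\eta))A(\eta)\,\Delta\eta<\frac{1-\lambda_0}{1+\lambda_0A(t)\mu(t)}\quad\text{for all }t\in[t_0,\infty)_{\mathbb{T}},$$ and assume that there exist $M_1,\lambda_1>0$ such that $$\mathrm{e}_{\ominus(\lambda_0A)}(t,s)\le M_1\,\mathrm{e}_{\ominus\lambda_1}(t,s)\quad\text{for all }t,s\in\mathbb{T}\text{ with }t\ge s\ge t_0 .$$ Then the trivial solution of (E)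 is uniformly exponentially stable.
   Context: Time scales: a time scale $\mathbb{T}$ is a nonempty closed subset of $\mathbb{R}$; an interval with subscript $\mathbb{T}$ means its intersection with $\mathbb{T}$. $\sigma(t)=\inf(t,\infty)_{\mathbb{T}}$, $\mu(t)=\sigma(t)-t$; $t$ is right-dense if $\mu(t)=0$, right-scattered otherwise. $f^{\Delta}(t)$ is the $\Delta$-derivative: for every $\varepsilon>0$ there is a neighbourhood $U$ of $t$ in $\mathbb T$ with $|f(\sigma(t))-f(r)-f^{\Delta}(t)(\sigma(t)-r)|\le\varepsilon|\sigma(t)-r|$ for $r\in U$. A function is rd-continuous if it is continuous at right-dense points and has finite left limits at left-dense points. $\int_s^t f(\eta)\Delta\eta$ is the $\Delta$-integral, i.e. $\int_{[s,t)\cap\mathbb{T}}f\,d\eta+\sum_{\eta\in[s,t)_{\mathbb{T}},\ \mu(\eta)>0}\mu(\eta)f(\eta)$ for $s\le t$. For $f$ with $1+\mu f>0$, $\mathrm{e}_f(t,s)=\exp\{\int_s^t\xi_{\mu(\eta)}(f(\eta))\Delta\eta\}$ with $\xi_0(z)=z$, $\xi_h(z)=\frac1h\ln(1+hz)$ for $h>0$ (with $\int_s^t=-\int_t^s$ if $t<s$); $\ominus f:=-f/(1+\mu f)$. Convention: $A$ is taken to be $0$ at points of $\mathbb{T}$ below $t_0$; integrands with factor $A(\eta)$ are $0$ for $\eta<t_0$. Delay functions: $\alpha_*(t):=\inf\{\alpha(\eta):\eta\in[t,\infty)_{\mathbb{T}}\}$ and $\alpha_{-1}(t):=\sup\{\eta\in[t_0,\infty)_{\mathbb{T}}:\alpha_*(\eta)\le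 t\}$ for $t\in[t_0,\infty)_{\mathbb T}$. Initial value problem: for $s\in[t_0,\infty)_{\mathbb{T}}$, $x_0\in\mathbb{R}$ and bounded rd-continuous $\varphi:[\alpha_*(s),s)_{\mathbb{T}}\to\mathbb{R}$, the solution of (E) with data $(s,x_0,\varphi)$ is the function $x:[\alpha_*(s),\infty)_{\mathbb{T}}\to\mathbb{R}$ with $x=\varphi$ on $[\alpha_*(s),s)_{\mathbb{T}}$, $x(s)=x_0$, satisfying (E) on $[s,\infty)_{\mathbb{T}}$, understood as $x(t)=x_0-\int_s^tA(\eta)x(\alpha(\eta))\Delta\eta$ for $t\in[s,\infty)_{\mathbb{T}}$. Uniform exponential stability of the trivial solution: there are $M,\lambda>0$ such that for every $s\in[t_0,\infty)_{\mathbb{T}}$, every solution $x$ with data $(s,x_0,\varphi)$ satisfies $|x(t)|\le M\,\mathrm{e}_{\ominus\lambda}(t,s)\big(|x_0|+\sup_{\eta\in[\alpha_*(s),s)_{\mathbb{T}}}|\varphi(\eta)|\big)$ for all $t\in[s,\infty)_{\mathbb{T}}$ (supremum over the empty set is $0$). *)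

theory Defs
  imports "HOL-Analysis.Analysis"
begin

definition time_scale :: "real set \<Rightarrow> bool" where
  "time_scale T \<longleftrightarrow> closed T \<and> T \<noteq> {}"

definition fwd_jump :: "real set \<Rightarrow> real \<Rightarrow> real" where
  "fwd_jump T t = Inf (T \<inter> {t<..})"

definition graininess :: "real set \<Rightarrow> real \<Rightarrow> real" where
  "graininess T t = fwd_jump T t - t"

text \<open>The domain \<open>D\<close> is an interval of \<open>T\<close>. Limits are taken within \<open>D\<close>, so nothing
  is required from the left at a left endpoint of \<open>D\<close>.\<close>

definition rd_continuous_on :: "real set \<Rightarrow> real set \<Rightarrow> (real \<Rightarrow> real) \<Rightarrow> bool" where
  "rd_continuous_on T D f \<longleftrightarrow>
     (\<forall>t\<in>D. (graininess T t = 0 \<longrightarrow> continuous (at t within D) f) \<and>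
            (t islimpt (D \<inter> {..<t}) \<longrightarrow> (\<exists>l. (f \<longlongrightarrow> l) (at t within (D \<inter> {..<t})))))"

definition scattered_in :: "real set \<Rightarrow> real \<Rightarrow> real \<Rightarrow> real set" where
  "scattered_in T s t = {\<eta> \<in> T \<inter> {s..<t}. graininess T \<eta> > 0}"

text \<open>The Lebesgue form of the delta integral: Lebesgue measure on the time scale plus an atom
  of mass \<open>graininess T \<eta>\<close> at each of the (countably many) right-scattered points \<open>\<eta>\<close>.\<close>

definition delta_integrable :: "real set \<Rightarrow> real \<Rightarrow> real \<Rightarrow> (real \<Rightarrow> real) \<Rightarrow> bool" where
  "delta_integrable T s t f \<longleftrightarrow>
     set_integrable lborel (T \<inter> {s..<t}) f \<and>
     (\<lambda>\<eta>. graininess T \<eta> * f \<eta>) summable_on scattered_in T s t"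

definition delta_integral :: "real set \<Rightarrow> real \<Rightarrow> real \<Rightarrow> (real \<Rightarrow> real) \<Rightarrow> real" where
  "delta_integral T s t f =
     (let I = (\<lambda>a b. set_lebesgue_integral lborel (T \<inter> {a..<b}) f
                      + infsum (\<lambda>\<eta>. graininess T \<eta> * f \<eta>) (scattered_in T a b))
      in if s \<le> t then I s t else - I t s)"

definition cylinder :: "real \<Rightarrow> real \<Rightarrow> real" where
  "cylinder h z = (if h = 0 then z else ln (1 + h * z) / h)"

definition ts_exp :: "real set \<Rightarrow> (real \<Rightarrow> real) \<Rightarrow> real \<Rightarrow> real \<Rightarrow> real" where
  "ts_exp T f t s = exp (delta_integral T s t (\<lambda>\<eta>. cylinder (graininess T \<eta>) (f \<eta>)))"

definition ominus :: "real set \<Rightarrow> (real \<Rightarrow> real) \<Rightarrow> real \<Rightarrow> real" where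
  "ominus T f = (\<lambda>t. - f t / (1 + graininess T t * f t))"

definition delay_low :: "real set \<Rightarrow> (real \<Rightarrow> real) \<Rightarrow> real \<Rightarrow> real" where
  "delay_low T \<alpha> t = (INF \<eta>\<in>T \<inter> {t..}. \<alpha> \<eta>)"

definition delay_inv :: "real set \<Rightarrow> real \<Rightarrow> (real \<Rightarrow> real) \<Rightarrow> real \<Rightarrow> real" where
  "delay_inv T t0 \<alpha> t = Sup {\<eta> \<in> T \<inter> {t0..}. delay_low T \<alpha> \<eta> \<le> t}"

definition history_dom :: "real set \<Rightarrow> (real \<Rightarrow> real) \<Rightarrow> real \<Rightarrow> real set" where
  "history_dom T \<alpha> s = T \<inter> {delay_low T \<alpha> s..<s}"

definition initial_function :: "real set \<Rightarrow> (real \<Rightarrow> real) \<Rightarrow> real \<Rightarrow> (real \<Rightarrow> real) \<Rightarrow> bool" where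
  "initial_function T \<alpha> s \<phi> \<longleftrightarrow>
     bounded (\<phi> ` history_dom T \<alpha> s) \<and> rd_continuous_on T (history_dom T \<alpha> s) \<phi>"

text \<open>A solution is only constrained on \<open>T \<inter> {delay_low T \<alpha> s..}\<close>; its other values are
  irrelevant. Integrability is stated because both parts of \<open>delta_integral\<close> default to zero
  for functions that are not integrable or summable.\<close>

definition is_solution ::
  "real set \<Rightarrow> (real \<Rightarrow> real) \<Rightarrow> (real \<Rightarrow> real) \<Rightarrow> real \<Rightarrow> real \<Rightarrow> (real \<Rightarrow> real) \<Rightarrow> (real \<Rightarrow> real) \<Rightarrow> bool" where
  "is_solution T A \<alpha> s x0 \<phi> x \<longleftrightarrow>
     (\<forall>t\<in>history_dom T \<alpha> s. x t = \<phi> t) \<and> x s = x0 \<and>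
     (\<forall>t\<in>T \<inter> {s..}. delta_integrable T s t (\<lambda>\<eta>. A \<eta> * x (\<alpha> \<eta>)) \<and>
                    x t = x0 - delta_integral T s t (\<lambda>\<eta>. A \<eta> * x (\<alpha> \<eta>)))"

definition history_norm :: "real set \<Rightarrow> (real \<Rightarrow> real) \<Rightarrow> real \<Rightarrow> (real \<Rightarrow> real) \<Rightarrow> real" where
  "history_norm T \<alpha> s \<phi> =
     (if history_dom T \<alpha> s = {} then 0 else (SUP \<eta>\<in>history_dom T \<alpha> s. \<bar>\<phi> \<eta>\<bar>))"

definition uniformly_exponentially_stable ::
  "real set \<Rightarrow> real \<Rightarrow> (real \<Rightarrow> real) \<Rightarrow> (real \<Rightarrow> real) \<Rightarrow> bool" where
  "uniformly_exponentially_stable T t0 A \<alpha> \<longleftrightarrow>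
     (\<exists>M>0. \<exists>l>0. \<forall>s\<in>T \<inter> {t0..}. \<forall>x0 \<phi> x.
        initial_function T \<alpha> s \<phi> \<longrightarrow> is_solution T A \<alpha> s x0 \<phi> x \<longrightarrow>
        (\<forall>t\<in>T \<inter> {s..}. \<bar>x t\<bar> \<le> M * ts_exp T (ominus T (\<lambda>_. l)) t s
                                   * (\<bar>x0\<bar> + history_norm T \<alpha> s \<phi>)))"

end

theory Submission
  imports Defs
begin

text \<open>Every \<open>\<Delta>\<close>-integral is an ordinary integral over a real interval: compose the integrand with
  the map \<open>ts_floor\<close> sending \<open>u\<close> to the last point of \<open>T\<close> not after \<open>u\<close>, so that the atom at a
  right-scattered point is spread over the gap to its right.

  Write \<open>E\<close> for the reciprocal of the exponential function of \<open>\<lambda>\<^sub>0 A\<close> and let \<open>x\<close> be a solution.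
  Gronwall's inequality bounds \<open>x\<close> up to \<open>\<sigma>(\<alpha>\<^sub>-\<^sub>1(s))\<close> in terms of the initial data, hence by \<open>C E\<close>.
  After that point \<open>x\<^sup>\<Delta> = - A x\<^sup>\<sigma> + A g\<close>, where \<open>g\<close> is the integral of \<open>A x(\<alpha>)\<close> over the delay
  window. If \<open>\<bar>x\<bar> \<le> K E\<close>, the smallness condition on \<open>\<lambda>\<^sub>0\<close> says \<open>\<bar>g\<bar> \<le> (1 - \<lambda>\<^sub>0) K E\<^sup>\<sigma>\<close>, and
  since \<open>E\<^sup>\<Delta> = - \<lambda>\<^sub>0 A E\<^sup>\<sigma>\<close>, both functions \<open>w = K E \<mp> x\<close> satisfy \<open>w\<^sup>\<Delta> \<ge> - A w\<^sup>\<sigma>\<close> and stay away from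
  zero on compact intervals. Thus every bound \<open>K > C\<close> can be improved and \<open>\<bar>x\<bar> \<le> C E\<close>.\<close>

section \<open>Integrals of locally bounded Borel functions\<close>

lemma has_sum_set_integral_UN:
  fixes f :: "'a \<Rightarrow> real"
  assumes "countable I" and meas: "\<And>i. i \<in> I \<Longrightarrow> A i \<in> sets M"
    and disj: "disjoint_family_on A I"
    and int: "set_integrable M (\<Union>i\<in>I. A i) f"
  shows "((\<lambda>i. LINT x:A i|M. f x) has_sum (LINT x:(\<Union>i\<in>I. A i)|M. f x)) I"
proof -
  define B where "B n = (if n \<in> to_nat_on I ` I then A (from_nat_into I n) else {})" for n
  have BA: "B (to_nat_on I i) = A i" if "i \<in> I" for i
    using that assms(1) by (auto simp: B_def)
  have B_meas: "B n \<in> sets M" for n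
    using meas \<open>countable I\<close> by (auto simp: B_def)
  have B_disj: "B m \<inter> B n = {}" if "m \<noteq> n" for m n
    using that disj \<open>countable I\<close> by (auto simp: B_def disjoint_family_on_def) blast
  have UB: "(\<Union>n. B n) = (\<Union>i\<in>I. A i)"
    using \<open>countable I\<close> BA by (auto simp: B_def split: if_splits)
  have int_norm: "set_integrable M (\<Union>i\<in>I. A i) (\<lambda>x. norm (f x))"
    using int by (rule set_integrable_norm)
  have int_B: "set_integrable M (B n) f" "set_integrable M (B n) (\<lambda>x. norm (f x))" for n
    using UB by (blast intro: set_integrable_subset[OF int B_meas] set_integrable_subset[OF int_norm B_meas])+
  have "summable (\<lambda>n. norm (LINT x:B n|M. f x))"
  proof (rule summableI_nonneg_bounded)
    fix n
    have "(\<Sum>i<n. norm (LINT x:B i|M. f x)) \<le> (\<Sum>i<n. LINT x:B i|M. norm (f x))"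
      by (intro sum_mono set_integral_norm_bound int_B)
    also have "\<dots> = (LINT x:(\<Union>i\<in>{..<n}. B i)|M. norm (f x))"
      by (rule set_integral_finite_Union[symmetric])
        (use int_B B_disj B_meas in \<open>auto simp: disjoint_family_on_def\<close>)
    also have "\<dots> \<le> (LINT x:(\<Union>i\<in>I. A i)|M. norm (f x))"
    proof -
      have "set_integrable M (\<Union>i\<in>{..<n}. B i) (\<lambda>x. norm (f x))"
        using UB B_meas by (intro set_integrable_subset[OF int_norm]) auto
      then show ?thesis
        using int_norm UB unfolding set_lebesgue_integral_def set_integrable_def
        by (intro integral_mono) (auto split: split_indicator)
    qed
    finally show "(\<Sum>i<n. norm (LINT x:B i|M. f x)) \<le> (LINT x:(\<Union>i\<in>I. A i)|M. norm (f x))" .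
  qed auto
  moreover from this have "(\<lambda>n. LINT x:B n|M. f x) sums (LINT x:(\<Union>n. B n)|M. f x)"
    using B_meas B_disj int UB
    by (subst lebesgue_integral_countable_add) (auto intro: summable_sums summable_rabs_cancel)
  ultimately have "((\<lambda>n. LINT x:B n|M. f x) has_sum (LINT x:(\<Union>i\<in>I. A i)|M. f x)) UNIV"
    unfolding UB by (rule norm_summable_imp_has_sum)
  then have "((\<lambda>n. LINT x:B n|M. f x) has_sum (LINT x:(\<Union>i\<in>I. A i)|M. f x)) (to_nat_on I ` I)"
    by (rule has_sum_cong_neutral[THEN iffD1, rotated -1])
      (auto simp: B_def set_lebesgue_integral_def)
  then have "(((\<lambda>n. LINT x:B n|M. f x) \<circ> to_nat_on I) has_sum (LINT x:(\<Union>i\<in>I. A i)|M. f x)) I"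
    using \<open>countable I\<close> by (subst (asm) has_sum_reindex) auto
  then show ?thesis
    by (rule has_sum_cong[THEN iffD1, rotated]) (use BA in auto)
qed

text \<open>The difference quotients at \<open>x\<close> are bounded by
  \<open>C * \<bar>y - x\<bar>\<close>, so the derivative vanishes everywhere.\<close>

lemma quadratic_increments_imp_constant:
  fixes Q :: "real \<Rightarrow> real"
  assumes "a \<le> b" and bound: "\<And>u v. a \<le> u \<Longrightarrow> u \<le> v \<Longrightarrow> v \<le> b \<Longrightarrow> \<bar>Q v - Q u\<bar> \<le> C * (v - u)\<^sup>2"
  shows "Q b = Q a"
proof -
  have "(Q has_field_derivative 0) (at x within {a..b})" if x: "x \<in> {a..b}" for x
  proof -
    have "((\<lambda>y. (Q y - Q x) / (y - x)) \<longlongrightarrow> 0) (at x within {a..b})"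
    proof (rule Lim_null_comparison)
      show "\<forall>\<^sub>F y in at x within {a..b}. norm ((Q y - Q x) / (y - x)) \<le> C * \<bar>y - x\<bar>"
        unfolding eventually_at_filter
      proof (intro always_eventually allI impI)
        fix y assume y: "y \<noteq> x" "y \<in> {a..b}"
        have "\<bar>Q y - Q x\<bar> \<le> C * (y - x)\<^sup>2"
          using bound[of x y] bound[of y x] x y by (cases "x \<le> y") (auto simp: abs_minus_commute power2_commute)
        then show "norm ((Q y - Q x) / (y - x)) \<le> C * \<bar>y - x\<bar>"
          using y by (simp add: divide_le_eq power2_eq_square abs_mult_self_eq mult.assoc)
      qed
      have "((\<lambda>y. C * \<bar>y - x\<bar>) \<longlongrightarrow> C * \<bar>x - x\<bar>) (at x within {a..b})"
        by (intro tendsto_intros)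
      then show "((\<lambda>y. C * \<bar>y - x\<bar>) \<longlongrightarrow> 0) (at x within {a..b})" by simp
    qed
    then show ?thesis by (simp add: has_field_derivative_iff)
  qed
  then have "\<exists>c. \<forall>x\<in>{a..b}. Q x = c"
    by (intro has_field_derivative_zero_constant) auto
  then show ?thesis using \<open>a \<le> b\<close> by force
qed

text \<open>This class is closed under sums and products, contains continuous and monotone
  functions, and consists of functions integrable on compact intervals. Integrability goals thereby
  reduce to closure rules, although the integrands jump at scattered points.\<close>

definition locally_bounded_borel :: "(real \<Rightarrow> real) \<Rightarrow> bool" where
  "locally_bounded_borel f \<longleftrightarrow> f \<in> borel_measurable borel \<and> (\<forall>a b. \<exists>B. \<forall>u\<in>{a..b}. \<bar>f u\<bar> \<le> B)"

lemma locally_bounded_borelI: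
  assumes "f \<in> borel_measurable borel" "\<And>a b. \<exists>B. \<forall>u\<in>{a..b}. \<bar>f u\<bar> \<le> B"
  shows "locally_bounded_borel f"
  using assms by (simp add: locally_bounded_borel_def)

lemma locally_bounded_borel_measurable [measurable_dest]:
  "locally_bounded_borel f \<Longrightarrow> f \<in> borel_measurable borel"
  by (simp add: locally_bounded_borel_def)

lemma locally_bounded_borelE:
  assumes "locally_bounded_borel f"
  obtains B where "B \<ge> 0" "\<And>u. u \<in> {a..b} \<Longrightarrow> \<bar>f u\<bar> \<le> B"
proof -
  obtain B where "\<forall>u\<in>{a..b}. \<bar>f u\<bar> \<le> B"
    using assms unfolding locally_bounded_borel_def by meson
  then show ?thesis using that[of "max B 0"] by force
qed

lemma locally_bounded_borel_set_integrable:
  assumes "locally_bounded_borel f"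
  shows "set_integrable lborel {a..b} f"
proof -
  obtain B where "B \<ge> 0" and B: "\<And>u. u \<in> {a..b} \<Longrightarrow> \<bar>f u\<bar> \<le> B"
    using locally_bounded_borelE[OF assms] by metis
  have f [measurable]: "f \<in> borel_measurable borel" using assms by measurable
  have "integrable lborel (\<lambda>x. indicator {a..b} x *\<^sub>R B)"
    by (rule integrable_scaleR_left) (rule integrable_real_indicator, auto simp: emeasure_lborel_Icc_eq)
  then show ?thesis
    unfolding set_integrable_def
    by (rule Bochner_Integration.integrable_bound) (use B \<open>B \<ge> 0\<close> in \<open>auto split: split_indicator intro!: AE_I2\<close>)
qed

lemma locally_bounded_borel_integrable_on:
  "locally_bounded_borel f \<Longrightarrow> f integrable_on {a..b}"
  using locally_bounded_borel_set_integrable set_borel_integral_eq_integral by blast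

lemma locally_bounded_borel_add:
  assumes "locally_bounded_borel f" "locally_bounded_borel g"
  shows "locally_bounded_borel (\<lambda>u. f u + g u)"
proof (rule locally_bounded_borelI)
  show "(\<lambda>u. f u + g u) \<in> borel_measurable borel" using assms by measurable
  fix a b :: real
  obtain B C where "\<And>u. u \<in> {a..b} \<Longrightarrow> \<bar>f u\<bar> \<le> B" "\<And>u. u \<in> {a..b} \<Longrightarrow> \<bar>g u\<bar> \<le> C"
    using locally_bounded_borelE assms by metis
  then show "\<exists>B. \<forall>u\<in>{a..b}. \<bar>f u + g u\<bar> \<le> B"
    by (intro exI[of _ "B + C"]) (use add_mono in fastforce)
qed

lemma locally_bounded_borel_mult:
  assumes "locally_bounded_borel f" "locally_bounded_borel g"
  shows "locally_bounded_borel (\<lambda>u. f u * g u)"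
proof (rule locally_bounded_borelI)
  show "(\<lambda>u. f u * g u) \<in> borel_measurable borel" using assms by measurable
  fix a b :: real
  obtain B where "B \<ge> 0" "\<And>u. u \<in> {a..b} \<Longrightarrow> \<bar>f u\<bar> \<le> B"
    using locally_bounded_borelE[OF assms(1)] by metis
  moreover obtain C where "\<And>u. u \<in> {a..b} \<Longrightarrow> \<bar>g u\<bar> \<le> C"
    using locally_bounded_borelE[OF assms(2)] by metis
  ultimately show "\<exists>B. \<forall>u\<in>{a..b}. \<bar>f u * g u\<bar> \<le> B"
    by (intro exI[of _ "B * C"]) (auto simp: abs_mult intro!: mult_mono)
qed

lemma locally_bounded_borel_const: "locally_bounded_borel (\<lambda>_. k)"
  by (rule locally_bounded_borelI) auto

lemma locally_bounded_borel_continuous: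
  assumes "continuous_on UNIV f"
  shows "locally_bounded_borel f"
proof (rule locally_bounded_borelI)
  show "f \<in> borel_measurable borel" using assms by (rule borel_measurable_continuous_onI)
  fix a b
  have "compact (f ` {a..b})"
    using assms by (intro compact_continuous_image) (auto intro: continuous_on_subset)
  then show "\<exists>B. \<forall>u\<in>{a..b}. \<bar>f u\<bar> \<le> B"
    by (auto dest!: compact_imp_bounded simp: bounded_iff)
qed

lemma locally_bounded_borel_mono:
  assumes "mono f"
  shows "locally_bounded_borel f"
proof (rule locally_bounded_borelI)
  show "f \<in> borel_measurable borel" using assms by (rule borel_measurable_mono)
  fix a b
  show "\<exists>B. \<forall>u\<in>{a..b}. \<bar>f u\<bar> \<le> B"
  proof (intro exI ballI)
    fix u assume "u \<in> {a..b}"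
    then have "f a \<le> f u" "f u \<le> f b" using assms by (auto simp: mono_def)
    then show "\<bar>f u\<bar> \<le> \<bar>f a\<bar> + \<bar>f b\<bar>" by linarith
  qed
qed

lemmas locally_bounded_borel_intros =
  locally_bounded_borel_add locally_bounded_borel_mult locally_bounded_borel_const

text \<open>A Riemann-type substitute for the chain rule: \<open>k\<close> need not be continuous, but the error
  of the first-order expansion of \<open>exp\<close> is quadratic in the increment.\<close>

lemma continuous_indefinite_integral:
  assumes k: "locally_bounded_borel k"
  shows "continuous_on UNIV (\<lambda>u. integral {a..u} k)"
proof -
  have "continuous_on {..<n} (\<lambda>u. integral {a..u} k)" for n
  proof -
    have "continuous_on {a..max a n} (\<lambda>u. integral {a..u} k)"
      by (intro indefinite_integral_continuous_1 locally_bounded_borel_integrable_on k)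
    \<comment> \<open>Composition with \<open>max a u\<close> extends continuity below
      \<open>a\<close>, where the interval is empty and the integral is 0.\<close>
    then have "continuous_on {..<n} (\<lambda>u. integral {a..max a u} k)"
      by (rule continuous_on_compose2) (auto intro!: continuous_intros)
    moreover have "integral {a..max a u} k = integral {a..u} k" for u
      by (cases "a \<le> u") (auto simp: max_def)
    ultimately show ?thesis by simp
  qed
  then have "continuous_on (\<Union>n\<in>UNIV. {..<n::real}) (\<lambda>u. integral {a..u} k)"
    by (intro continuous_on_open_UN) auto
  moreover have "(\<Union>n\<in>UNIV. {..<n::real}) = UNIV" using lt_ex gt_ex by blast
  ultimately show ?thesis by simp
qed

lemma integral_diff:
  assumes "locally_bounded_borel k" "a \<le> u" "u \<le> v"
  shows "integral {a..v} k - integral {a..u} k = integral {u..v} k"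
  using Henstock_Kurzweil_Integration.integral_combine[OF assms(2,3) locally_bounded_borel_integrable_on[OF assms(1)]]
  by simp

lemma abs_integral_le:
  assumes "locally_bounded_borel k" "u \<le> v" "\<And>w. w \<in> {u..v} \<Longrightarrow> \<bar>k w\<bar> \<le> B"
  shows "\<bar>integral {u..v} k\<bar> \<le> B * (v - u)"
proof -
  have "norm (integral {u..v} k) \<le> integral {u..v} (\<lambda>_. B)"
    by (rule integral_norm_bound_integral) (use assms locally_bounded_borel_integrable_on in auto)
  then show ?thesis using assms by (simp add: mult.commute)
qed

text \<open>The Lagrange remainder \<open>exp y / 2 * z\<^sup>2\<close> has
  \<open>\<bar>y\<bar> \<le> \<bar>z\<bar>\<close>, hence \<open>y \<le> R\<close>.\<close>

lemma abs_exp_minus_one_minus_self_le: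
  fixes z :: real
  assumes "\<bar>z\<bar> \<le> R"
  shows "\<bar>exp z - 1 - z\<bar> \<le> exp R * z\<^sup>2"
proof -
  obtain y where y: "\<bar>y\<bar> \<le> \<bar>z\<bar>" and e: "exp z = (\<Sum>m<2. z ^ m / fact m) + exp y / fact 2 * z ^ 2"
    using Maclaurin_exp_le[of z 2] by auto
  have "exp y \<le> exp R" using y assms by simp
  then have "exp y / 2 * z\<^sup>2 \<le> exp R * z\<^sup>2"
    by (intro mult_right_mono) (use exp_gt_zero[of R] in linarith, simp)
  moreover have "0 \<le> exp y / 2 * z\<^sup>2" by simp
  ultimately show ?thesis using e by (simp add: numeral_2_eq_2)
qed

lemma exp_integral_diff:
  assumes k: "locally_bounded_borel k" and "a \<le> t" "t \<le> t'"
  shows "exp (integral {a..t'} k) - exp (integral {a..t} k)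
           = integral {t..t'} (\<lambda>u. k u * exp (integral {a..u} k))"
proof -
  obtain B where "B \<ge> 0" and B: "\<And>u. u \<in> {a..t'} \<Longrightarrow> \<bar>k u\<bar> \<le> B"
    using locally_bounded_borelE[OF k] by metis
  define F where "F u = integral {a..u} k" for u
  have F_diff: "F v - F u = integral {u..v} k" if "a \<le> u" "u \<le> v" for u v
    unfolding F_def using k that by (rule integral_diff)
  have F_lip: "\<bar>F v - F u\<bar> \<le> B * (v - u)" if "a \<le> u" "u \<le> v" "v \<le> t'" for u v
    using abs_integral_le[OF k, of u v B] F_diff that B by auto
  have eF: "locally_bounded_borel (\<lambda>u. exp (F u))"
    unfolding F_def
    by (intro locally_bounded_borel_continuous continuous_on_exp continuous_indefinite_integral k)
  obtain D where "D \<ge> 0" and D: "\<And>u. u \<in> {a..t'} \<Longrightarrow> \<bar>exp (F u)\<bar> \<le> D"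
    using locally_bounded_borelE[OF eF] by metis
  \<comment> \<open>\<open>R\<close> bounds every increment of \<open>F\<close> on the interval, so
    the expansion of \<open>exp\<close> has the uniform error constant \<open>exp R\<close>.\<close>
  define R where "R = B * (t' - a)"
  have kF: "locally_bounded_borel (\<lambda>u. k u * exp (F u))"
    by (intro locally_bounded_borel_intros k eF)
  \<comment> \<open>The claim says that \<open>Q\<close> takes the same value at \<open>t\<close>
    and \<open>t'\<close>.\<close>
  define Q where "Q u = exp (F u) - integral {a..u} (\<lambda>u. k u * exp (F u))" for u
  \<comment> \<open>The first summand of the constant is the second-order error of
    \<open>exp\<close>; the second comes from freezing \<open>exp (F w)\<close> at
    \<open>w = u\<close> under the integral.\<close>
  have step: "\<bar>Q v - Q u\<bar> \<le> (D * exp R * B\<^sup>2 + B * (D * (exp R * B\<^sup>2 * (t' - a) + B))) * (v - u)\<^sup>2"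
    if uv: "t \<le> u" "u \<le> v" "v \<le> t'" for u v
  proof -
    have small: "\<bar>F w - F u\<bar> \<le> R" if "u \<le> w" "w \<le> v" for w
    proof -
      have "\<bar>F w - F u\<bar> \<le> B * (w - u)" using F_lip uv that assms by auto
      also have "\<dots> \<le> R" unfolding R_def
        using uv that assms \<open>B \<ge> 0\<close> by (intro mult_left_mono) auto
      finally show ?thesis .
    qed
    have sq: "(F w - F u)\<^sup>2 \<le> B\<^sup>2 * (w - u)\<^sup>2" if "u \<le> w" "w \<le> v" for w
    proof -
      have "\<bar>F w - F u\<bar>\<^sup>2 \<le> (B * (w - u))\<^sup>2"
        using F_lip uv that assms by (intro power_mono) auto
      then show ?thesis by (simp add: power_mult_distrib)
    qed
    have e1: "\<bar>exp (F w - F u) - 1 - (F w - F u)\<bar> \<le> exp R * (B\<^sup>2 * (w - u)\<^sup>2)"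
      if "u \<le> w" "w \<le> v" for w
      using abs_exp_minus_one_minus_self_le[OF small[OF that]] sq[OF that]
      by (smt (verit) exp_gt_zero mult_left_mono)
    have ediff: "exp (F w) - exp (F u) = exp (F u) * (exp (F w - F u) - 1)" for w
      by (simp add: exp_diff field_simps)
    have eFu: "0 \<le> exp (F u)" "exp (F u) \<le> D" using D[of u] uv assms by auto
    have e2: "\<bar>exp (F w) - exp (F u)\<bar> \<le> D * (exp R * B\<^sup>2 * (t' - a) + B) * (v - u)"
      if w: "u \<le> w" "w \<le> v" for w
    proof -
      have "(w - u)\<^sup>2 \<le> (t' - a) * (v - u)"
        unfolding power2_eq_square using w uv assms by (intro mult_mono) auto
      then have "exp R * (B\<^sup>2 * (w - u)\<^sup>2) \<le> exp R * (B\<^sup>2 * ((t' - a) * (v - u)))"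
        by (intro mult_left_mono) auto
      moreover have "B * (w - u) \<le> B * (v - u)" using w \<open>B \<ge> 0\<close> by (intro mult_left_mono) auto
      moreover have "\<bar>exp (F w - F u) - 1\<bar> \<le> exp R * (B\<^sup>2 * (w - u)\<^sup>2) + B * (w - u)"
        using e1[OF w] F_lip[of u w] w uv assms by linarith
      ultimately have "\<bar>exp (F w - F u) - 1\<bar> \<le> (exp R * B\<^sup>2 * (t' - a) + B) * (v - u)"
        by (simp add: algebra_simps)
      then have "exp (F u) * \<bar>exp (F w - F u) - 1\<bar> \<le> D * ((exp R * B\<^sup>2 * (t' - a) + B) * (v - u))"
        using eFu \<open>D \<ge> 0\<close> by (intro mult_mono) auto
      then show ?thesis unfolding ediff by (simp add: abs_mult mult.assoc)
    qed
    have kd: "locally_bounded_borel (\<lambda>w. k w * exp (F u))"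
      by (intro locally_bounded_borel_intros k)
    have kdd: "locally_bounded_borel (\<lambda>w. k w * (exp (F w) + (- exp (F u))))"
      by (intro locally_bounded_borel_intros k eF)
    have "Q v - Q u = exp (F v) - exp (F u) - integral {u..v} (\<lambda>w. k w * exp (F w))"
      using integral_diff[OF kF, of a u v] uv assms by (simp add: Q_def)
    also have "integral {u..v} (\<lambda>w. k w * exp (F w))
      = integral {u..v} (\<lambda>w. k w * exp (F u) + k w * (exp (F w) + (- exp (F u))))"
      by (simp add: algebra_simps)
    also have "\<dots> = integral {u..v} (\<lambda>w. k w * exp (F u)) + integral {u..v} (\<lambda>w. k w * (exp (F w) + (- exp (F u))))"
      by (intro Henstock_Kurzweil_Integration.integral_add locally_bounded_borel_integrable_on kd kdd)
    also have "integral {u..v} (\<lambda>w. k w * exp (F u)) = (F v - F u) * exp (F u)"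
      using F_diff uv assms by simp
    finally have Qd: "Q v - Q u = exp (F u) * (exp (F v - F u) - 1 - (F v - F u))
        - integral {u..v} (\<lambda>w. k w * (exp (F w) + (- exp (F u))))"
      using ediff[of v] by (simp add: algebra_simps)
    have "\<bar>integral {u..v} (\<lambda>w. k w * (exp (F w) + (- exp (F u))))\<bar>
      \<le> (B * (D * (exp R * B\<^sup>2 * (t' - a) + B) * (v - u))) * (v - u)"
    proof (rule abs_integral_le[OF kdd uv(2)])
      fix w assume w: "w \<in> {u..v}"
      show "\<bar>k w * (exp (F w) + - exp (F u))\<bar> \<le> B * (D * (exp R * B\<^sup>2 * (t' - a) + B) * (v - u))"
        unfolding abs_mult using w uv assms B \<open>B \<ge> 0\<close> e2[of w] by (intro mult_mono) auto
    qed
    moreover have "\<bar>exp (F u) * (exp (F v - F u) - 1 - (F v - F u))\<bar> \<le> D * (exp R * (B\<^sup>2 * (v - u)\<^sup>2))"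
      unfolding abs_mult using eFu e1[of v] uv \<open>D \<ge> 0\<close> by (intro mult_mono) auto
    ultimately have "\<bar>Q v - Q u\<bar> \<le> D * (exp R * (B\<^sup>2 * (v - u)\<^sup>2))
        + (B * (D * (exp R * B\<^sup>2 * (t' - a) + B) * (v - u))) * (v - u)"
      unfolding Qd by linarith
    then show ?thesis by (simp add: algebra_simps power2_eq_square)
  qed
  have "Q t' = Q t"
    by (rule quadratic_increments_imp_constant[OF \<open>t \<le> t'\<close> step])
  then show ?thesis
    using integral_diff[OF kF assms(2,3)] by (simp add: Q_def F_def)
qed

section \<open>Delta integrals as integrals over real intervals\<close>

text \<open>The base point \<open>c\<close> is where all indefinite integrals start. For the
  equation it becomes the lowest delayed time \<open>delay_low T \<alpha> t0\<close>, which may lie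
  below \<open>t0\<close>.\<close>

locale unbounded_time_scale =
  fixes T :: "real set" and c :: real
  assumes closed_T: "closed T" and unbdd_T: "\<not> bdd_above T" and c_in_T: "c \<in> T"
begin

text \<open>The \<open>max\<close> keeps \<open>c\<close> in the set, which makes this a total
  monotone map into \<open>T \<inter> {c..}\<close>.\<close>

definition ts_floor :: "real \<Rightarrow> real" where
  "ts_floor u = Sup (T \<inter> {..max c u})"

lemma T_above: "\<exists>r\<in>T. t < r"
  using unbdd_T by (meson bdd_above.I not_le)

lemma fwd_jump_in_T: "fwd_jump T t \<in> T"
  and fwd_jump_ge: "t \<le> fwd_jump T t"
proof -
  have ne: "T \<inter> {t<..} \<noteq> {}" using T_above[of t] by auto
  have bdd: "bdd_below (T \<inter> {t<..})" by (auto intro!: bdd_belowI[of _ t])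
  have "fwd_jump T t \<in> closure (T \<inter> {t<..})"
    unfolding fwd_jump_def using closure_contains_Inf[OF ne bdd] .
  then show "fwd_jump T t \<in> T"
    using closed_T closure_minimal[of "T \<inter> {t<..}" T] by auto
  show "t \<le> fwd_jump T t"
    unfolding fwd_jump_def by (rule cInf_greatest[OF ne]) auto
qed

lemma fwd_jump_le: "r \<in> T \<Longrightarrow> t < r \<Longrightarrow> fwd_jump T t \<le> r"
  unfolding fwd_jump_def by (rule cInf_lower) (auto intro!: bdd_belowI[of _ t])

lemma fwd_jump_mono: "t \<le> u \<Longrightarrow> fwd_jump T t \<le> fwd_jump T u"
  unfolding fwd_jump_def
  using T_above[of u] by (intro cInf_superset_mono) (auto intro!: bdd_belowI[of _ t])

lemma graininess_nonneg: "0 \<le> graininess T t"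
  using fwd_jump_ge by (simp add: graininess_def)

lemma ts_floor_in_T: "ts_floor u \<in> T"
  and ts_floor_ge: "c \<le> ts_floor u"
  and ts_floor_le: "ts_floor u \<le> max c u"
proof -
  have c: "c \<in> T \<inter> {..max c u}" using c_in_T by auto
  have bdd: "bdd_above (T \<inter> {..max c u})" by (auto intro!: bdd_aboveI[of _ "max c u"])
  show "ts_floor u \<in> T"
    unfolding ts_floor_def
    using closed_contains_Sup[of "T \<inter> {..max c u}"] c bdd closed_Int[OF closed_T closed_atMost] by blast
  show "c \<le> ts_floor u" unfolding ts_floor_def using c bdd by (rule cSup_upper)
  show "ts_floor u \<le> max c u" unfolding ts_floor_def
    using c by (intro cSup_least) auto
qed

lemma ts_floor_greatest: "r \<in> T \<Longrightarrow> r \<le> u \<Longrightarrow> r \<le> ts_floor u"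
  unfolding ts_floor_def by (rule cSup_upper) (auto intro!: bdd_aboveI[of _ "max c u"])

lemma ts_floor_eq_self: "u \<in> T \<Longrightarrow> c \<le> u \<Longrightarrow> ts_floor u = u"
  using ts_floor_greatest[of u u] ts_floor_le[of u] by auto

lemma ts_floor_mono: "mono ts_floor"
proof
  fix u v :: real assume "u \<le> v"
  then show "ts_floor u \<le> ts_floor v"
    unfolding ts_floor_def using c_in_T
    by (intro cSup_subset_mono) (auto intro!: bdd_aboveI[of _ "max c v"])
qed

lemma ts_floor_le_self: "c \<le> u \<Longrightarrow> ts_floor u \<le> u"
  using ts_floor_le[of u] by auto

lemma ts_floor_eq: "r \<in> T \<Longrightarrow> c \<le> r \<Longrightarrow> r \<le> u \<Longrightarrow> u < fwd_jump T r \<Longrightarrow> ts_floor u = r"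
  using ts_floor_greatest[of r u] fwd_jump_le[OF ts_floor_in_T, of r u] ts_floor_le_self[of u]
  by force

text \<open>Otherwise the infimum defining the jump would provide a point of \<open>T\<close>
  strictly between \<open>ts_floor u\<close> and \<open>u\<close>.\<close>

lemma le_fwd_jump_ts_floor:
  assumes "c \<le> u"
  shows "u \<le> fwd_jump T (ts_floor u)"
proof (rule ccontr)
  assume "\<not> ?thesis"
  moreover have "T \<inter> {ts_floor u<..} \<noteq> {}" using T_above[of "ts_floor u"] by auto
  ultimately obtain r where "r \<in> T" "ts_floor u < r" "r < u"
    unfolding fwd_jump_def not_le
    by (subst (asm) cInf_less_iff) (auto intro!: bdd_belowI[of _ "ts_floor u"])
  then show False using ts_floor_greatest[of r u] by auto
qed

lemma fwd_jump_ts_floor_le: "t \<in> T \<Longrightarrow> c \<le> u \<Longrightarrow> u < t \<Longrightarrow> fwd_jump T (ts_floor u) \<le> t"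
  using fwd_jump_le[of t "ts_floor u"] ts_floor_le_self[of u] by auto

lemma ts_floor_interval:
  "s \<in> T \<Longrightarrow> c \<le> s \<Longrightarrow> u \<in> {s..<t} \<Longrightarrow> ts_floor u \<in> T \<inter> {s..<t}"
  using ts_floor_in_T[of u] ts_floor_greatest[of s u] ts_floor_le_self[of u] by auto

lemma T_borel [measurable]: "T \<in> sets borel"
  using closed_T by (rule borel_closed)

lemma scattered_iff: "r \<in> scattered_in T s t \<longleftrightarrow> r \<in> T \<and> s \<le> r \<and> r < t \<and> r < fwd_jump T r"
  by (auto simp: scattered_in_def graininess_def)

section \<open>Decomposition of an interval into \<open>T\<close> and its gaps\<close>

lemma gaps_disjoint:
  assumes "r \<in> T" "r' \<in> T" "r \<noteq> r'"
  shows "{r<..<fwd_jump T r} \<inter> {r'<..<fwd_jump T r'} = {}"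
  using assms fwd_jump_le[of r' r] fwd_jump_le[of r r'] by force

text \<open>Each right-scattered point has a rational in the gap to its right, and distinct gaps are
  disjoint.\<close>

lemma countable_right_scattered: "countable {r \<in> T. r < fwd_jump T r}"
proof -
  have "\<forall>r\<in>{r \<in> T. r < fwd_jump T r}. \<exists>x. x \<in> \<rat> \<and> x \<in> {r<..<fwd_jump T r}"
    using Rats_dense_in_real by auto
  then obtain f where f: "\<And>r. r \<in> T \<Longrightarrow> r < fwd_jump T r \<Longrightarrow> f r \<in> \<rat> \<and> f r \<in> {r<..<fwd_jump T r}"
    by (metis (mono_tags, lifting) mem_Collect_eq)
  have "inj_on f {r \<in> T. r < fwd_jump T r}"
    using f gaps_disjoint by (intro inj_onI) (metis (mono_tags, lifting) disjoint_iff mem_Collect_eq)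
  moreover have "countable (f ` {r \<in> T. r < fwd_jump T r})"
    using f by (intro countable_subset[OF _ countable_rat]) auto
  ultimately show ?thesis by (rule countable_image_inj_on[rotated])
qed

lemma countable_scattered_in: "countable (scattered_in T s t)"
  by (rule countable_subset[OF _ countable_right_scattered]) (auto simp: scattered_iff)

text \<open>A point outside \<open>T\<close> lies in the gap that starts at its floor. Since
  \<open>t \<in> T\<close>, no gap starting before \<open>t\<close> extends beyond
  \<open>t\<close>.\<close>

lemma interval_decomposition:
  assumes "s \<in> T" "t \<in> T" "c \<le> s"
  shows "{s..<t} = (T \<inter> {s..<t}) \<union> (\<Union>r\<in>scattered_in T s t. {r<..<fwd_jump T r})" (is "_ = ?R")
proof
  show "{s..<t} \<subseteq> ?R"
  proof
    fix u assume u: "u \<in> {s..<t}"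
    show "u \<in> ?R"
    proof (cases "u \<in> T")
      case False
      have r: "ts_floor u \<in> T \<inter> {s..<t}" using ts_floor_interval assms u by auto
      moreover have "ts_floor u < u" "u < fwd_jump T (ts_floor u)"
        using False ts_floor_in_T[of u] ts_floor_le_self[of u] le_fwd_jump_ts_floor[of u]
          fwd_jump_in_T[of "ts_floor u"] u assms
        by (auto simp: less_le)
      ultimately show ?thesis by (auto simp: scattered_iff intro!: bexI[of _ "ts_floor u"])
    qed (use u in auto)
  qed
  show "?R \<subseteq> {s..<t}"
    using fwd_jump_le[OF \<open>t \<in> T\<close>] by (force simp: scattered_iff)
qed

lemma gap_not_in_T: "u \<in> {r<..<fwd_jump T r} \<Longrightarrow> u \<notin> T"
  using fwd_jump_le[of u r] by auto

text \<open>Countable additivity over the gaps. For integrands of the form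
  \<open>f \<circ> ts_floor\<close> the gap integrals become the atoms of the delta
  integral.\<close>

lemma has_sum_gap_integrals:
  fixes k :: "real \<Rightarrow> real"
  assumes st: "s \<in> T" "t \<in> T" "c \<le> s" and k: "set_integrable lborel {s..<t} k"
  shows "((\<lambda>r. LINT u:{r<..<fwd_jump T r}|lborel. k u) has_sum
    ((LINT u:{s..<t}|lborel. k u) - (LINT u:T \<inter> {s..<t}|lborel. k u))) (scattered_in T s t)"
proof -
  define G where "G = (\<Union>r\<in>scattered_in T s t. {r<..<fwd_jump T r})"
  note dec = interval_decomposition[OF st, folded G_def]
  have G_open: "open G" by (auto simp: G_def)
  then have [measurable]: "G \<in> sets lborel" by simp
  have kG: "set_integrable lborel G k" and kT: "set_integrable lborel (T \<inter> {s..<t}) k"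
    using dec G_open by (auto intro!: set_integrable_subset[OF k])
  have "(T \<inter> {s..<t}) \<inter> G = {}"
    using gap_not_in_T by (auto simp: G_def)
  then have "(LINT u:{s..<t}|lborel. k u) = (LINT u:T \<inter> {s..<t}|lborel. k u) + (LINT u:G|lborel. k u)"
    by (subst dec) (intro set_integral_Un kG kT)
  moreover have "((\<lambda>r. LINT u:{r<..<fwd_jump T r}|lborel. k u) has_sum (LINT u:G|lborel. k u))
    (scattered_in T s t)"
    unfolding G_def
    by (rule has_sum_set_integral_UN)
      (use kG gaps_disjoint in \<open>auto simp: G_def countable_scattered_in disjoint_family_on_def scattered_iff\<close>)
  ultimately show ?thesis by simp
qed

text \<open>These are the conditions on \<open>f\<close> that make \<open>f \<circ> ts_floor\<close>
  a locally bounded Borel function; \<open>ts_floor\<close> only takes values in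
  \<open>T \<inter> {c..}\<close>, so nothing is asked elsewhere.\<close>

definition admissible :: "(real \<Rightarrow> real) \<Rightarrow> bool" where
  "admissible f \<longleftrightarrow> set_borel_measurable borel (T \<inter> {c..}) f \<and>
     (\<forall>b. \<exists>B. \<forall>\<eta>\<in>T \<inter> {c..b}. \<bar>f \<eta>\<bar> \<le> B)"

lemma admissible_locally_bounded_borel:
  assumes "admissible f"
  shows "locally_bounded_borel (\<lambda>u. f (ts_floor u))"
proof (rule locally_bounded_borelI)
  have [measurable]: "(\<lambda>\<eta>. indicator (T \<inter> {c..}) \<eta> *\<^sub>R f \<eta>) \<in> borel_measurable borel"
    using assms by (simp add: admissible_def set_borel_measurable_def)
  have [measurable]: "ts_floor \<in> borel_measurable borel"
    using ts_floor_mono by (rule borel_measurable_mono)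
  have "(\<lambda>u. (\<lambda>\<eta>. indicator (T \<inter> {c..}) \<eta> *\<^sub>R f \<eta>) (ts_floor u)) \<in> borel_measurable borel"
    by measurable
  then show "(\<lambda>u. f (ts_floor u)) \<in> borel_measurable borel"
    using ts_floor_in_T ts_floor_ge by simp
  fix a b :: real
  obtain B where "\<forall>\<eta>\<in>T \<inter> {c..max c b}. \<bar>f \<eta>\<bar> \<le> B"
    using assms by (auto simp: admissible_def)
  moreover have "ts_floor u \<in> T \<inter> {c..max c b}" if "u \<in> {a..b}" for u
    using ts_floor_in_T[of u] ts_floor_ge[of u] ts_floor_le[of u] that by auto
  ultimately show "\<exists>B. \<forall>u\<in>{a..b}. \<bar>f (ts_floor u)\<bar> \<le> B" by blast
qed

lemma integral_gap_ts_floor: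
  assumes "r \<in> T" "c \<le> r"
  shows "(LINT u:{r<..<fwd_jump T r}|lborel. f (ts_floor u)) = graininess T r * f r"
proof -
  have "(LINT u:{r<..<fwd_jump T r}|lborel. f (ts_floor u)) = (LINT u:{r<..<fwd_jump T r}|lborel. f r)"
    using assms by (intro set_lebesgue_integral_cong) (auto simp: ts_floor_eq)
  also have "\<dots> = graininess T r * f r"
    using fwd_jump_ge[of r] by (simp add: set_integral_const graininess_def)
  finally show ?thesis .
qed

lemma set_integral_half_open_eq_integral:
  assumes "locally_bounded_borel k"
  shows "(LINT u:{s..<t}|lborel. k u) = integral {s..t} k"
proof -
  have "(LINT u:{s..<t}|lborel. k u) = integral {s..<t} k"
    by (intro set_borel_integral_eq_integral
      set_integrable_subset[OF locally_bounded_borel_set_integrable[OF assms, of s t]]) auto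
  also have "\<dots> = integral {s..t} k"
    by (rule integral_subset_negligible) (auto intro: negligible_subset[OF negligible_sing[of t]])
  finally show ?thesis .
qed

text \<open>On a gap the composed integrand is constant and reproduces the atom at the left end; on
  \<open>T\<close> the floor is the identity. The \<open>has_sum\<close> statement delivers the
  value of \<open>infsum\<close> together with its convergence.\<close>

lemma delta_integral_eq_integral:
  assumes f: "admissible f" and st: "s \<in> T" "t \<in> T" "c \<le> s" "s \<le> t"
  shows "delta_integral T s t f = integral {s..t} (\<lambda>u. f (ts_floor u))"
proof -
  note lb = admissible_locally_bounded_borel[OF f]
  have int: "set_integrable lborel {s..<t} (\<lambda>u. f (ts_floor u))"
    by (rule set_integrable_subset[OF locally_bounded_borel_set_integrable[OF lb, of s t]]) auto
  have "((\<lambda>r. graininess T r * f r) has_sum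
    ((LINT u:{s..<t}|lborel. f (ts_floor u)) - (LINT u:T \<inter> {s..<t}|lborel. f (ts_floor u)))) (scattered_in T s t)"
    by (rule has_sum_cong[THEN iffD1, OF _ has_sum_gap_integrals[OF st(1-3) int]])
      (use st in \<open>auto simp: scattered_iff intro!: integral_gap_ts_floor\<close>)
  moreover have "(LINT u:T \<inter> {s..<t}|lborel. f (ts_floor u)) = (LINT u:T \<inter> {s..<t}|lborel. f u)"
    using st by (intro set_lebesgue_integral_cong) (auto simp: ts_floor_eq_self)
  ultimately show ?thesis
    using st by (simp add: delta_integral_def infsumI set_integral_half_open_eq_integral[OF lb])
qed

text \<open>This serves to compare integrands that differ inside the gaps but have equal integrals
  over each of them. What remains is the part on \<open>T\<close>.\<close>

lemma integral_eq_zero_if_gapwise: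
  assumes k: "locally_bounded_borel k" and st: "s \<in> T" "t \<in> T" "c \<le> s"
    and dense: "\<And>u. u \<in> T \<Longrightarrow> s \<le> u \<Longrightarrow> u < t \<Longrightarrow> fwd_jump T u = u \<Longrightarrow> k u = 0"
    and gap: "\<And>r. r \<in> T \<Longrightarrow> s \<le> r \<Longrightarrow> r < t \<Longrightarrow> r < fwd_jump T r \<Longrightarrow> integral {r..fwd_jump T r} k = 0"
  shows "integral {s..t} k = 0"
proof -
  have int: "set_integrable lborel {s..<t} k"
    by (rule set_integrable_subset[OF locally_bounded_borel_set_integrable[OF k, of s t]]) auto
  have "(LINT u:{r<..<fwd_jump T r}|lborel. k u) = integral {r..fwd_jump T r} k" for r
  proof -
    have "(LINT u:{r<..<fwd_jump T r}|lborel. k u) = integral {r<..<fwd_jump T r} k"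
      by (intro set_borel_integral_eq_integral
        set_integrable_subset[OF locally_bounded_borel_set_integrable[OF k, of r "fwd_jump T r"]]) auto
    then show ?thesis by (simp add: integral_open_interval_real)
  qed
  then have "((\<lambda>r. LINT u:{r<..<fwd_jump T r}|lborel. k u) has_sum 0) (scattered_in T s t)"
    using gap by (intro has_sum_0) (auto simp: scattered_iff)
  with has_sum_gap_integrals[OF st int]
  have "(LINT u:{s..<t}|lborel. k u) = (LINT u:T \<inter> {s..<t}|lborel. k u)"
    using has_sum_unique by fastforce
  also have "\<dots> = 0"
  proof -
    \<comment> \<open>Right-scattered points form a countable null set, so vanishing at the
      right-dense points suffices.\<close>
    have "AE u in lborel. u \<notin> {r \<in> T. r < fwd_jump T r}"
      by (intro AE_not_in countable_imp_null_set_lborel countable_right_scattered)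
    then have "AE u in lborel. indicator (T \<inter> {s..<t}) u *\<^sub>R k u = 0"
    proof eventually_elim
      case (elim u)
      then show ?case
        using dense[of u] fwd_jump_ge[of u] by (auto split: split_indicator simp: less_le)
    qed
    then show ?thesis
      unfolding set_lebesgue_integral_def by (rule integral_eq_zero_AE)
  qed
  finally show ?thesis by (simp add: set_integral_half_open_eq_integral[OF k])
qed

end

lemma delta_integral_cong:
  assumes "s \<le> t" "\<And>\<eta>. \<eta> \<in> T \<Longrightarrow> s \<le> \<eta> \<Longrightarrow> \<eta> < t \<Longrightarrow> f \<eta> = g \<eta>"
  shows "delta_integral T s t f = delta_integral T s t g"
proof -
  have "(LINT \<eta>:T \<inter> {s..<t}|lborel. f \<eta>) = (LINT \<eta>:T \<inter> {s..<t}|lborel. g \<eta>)"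
    unfolding set_lebesgue_integral_def
    by (intro Bochner_Integration.integral_cong) (use assms in \<open>auto split: split_indicator\<close>)
  moreover have "infsum (\<lambda>\<eta>. graininess T \<eta> * f \<eta>) (scattered_in T s t)
    = infsum (\<lambda>\<eta>. graininess T \<eta> * g \<eta>) (scattered_in T s t)"
    by (intro infsum_cong) (use assms in \<open>auto simp: scattered_in_def\<close>)
  ultimately show ?thesis using \<open>s \<le> t\<close> by (simp add: delta_integral_def)
qed

section \<open>The exponential function\<close>

lemma cylinder_nonneg: "0 \<le> h \<Longrightarrow> 0 \<le> z \<Longrightarrow> 0 \<le> cylinder h z"
  by (auto simp: cylinder_def)

lemma cylinder_le: "0 \<le> h \<Longrightarrow> 0 \<le> z \<Longrightarrow> cylinder h z \<le> z"
  using ln_add_one_self_le_self[of "h * z"] by (auto simp: cylinder_def divide_le_eq mult.commute)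

text \<open>The factor \<open>1 + \<mu> (\<ominus>f)\<close> is the inverse of
  \<open>1 + \<mu> f\<close>, and the logarithm turns this into a change of sign.\<close>

lemma cylinder_ominus:
  assumes "0 \<le> graininess T t" "0 \<le> f t"
  shows "cylinder (graininess T t) (ominus T f t) = - cylinder (graininess T t) (f t)"
proof (cases "graininess T t = 0")
  case False
  have "0 < 1 + graininess T t * f t" using assms by (simp add: add_pos_nonneg)
  then have "1 + graininess T t * ominus T f t = inverse (1 + graininess T t * f t)"
    by (simp add: ominus_def field_simps)
  then show ?thesis
    using \<open>0 < 1 + graininess T t * f t\<close> False by (simp add: cylinder_def ln_inverse)
qed (simp add: cylinder_def ominus_def)

lemma borel_measurable_cylinder [measurable]:
  assumes [measurable]: "h \<in> borel_measurable M" "z \<in> borel_measurable M"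
  shows "(\<lambda>x. cylinder (h x) (z x)) \<in> borel_measurable M"
  unfolding cylinder_def by measurable

section \<open>Rd-continuous functions: boundedness and measurability\<close>

context unbounded_time_scale
begin

text \<open>At a right-dense point continuity gives the bound. At a right-scattered point the left
  limit, if the point is left-dense, controls the values before \<open>t\<close>, and no points of
  \<open>T\<close> follow within the gap.\<close>

lemma rd_continuous_on_locally_bounded:
  assumes f: "rd_continuous_on T (T \<inter> {t0..}) f" and t: "t \<in> T" "t0 \<le> t"
  shows "\<exists>U B. open U \<and> t \<in> U \<and> (\<forall>\<eta>\<in>U \<inter> (T \<inter> {t0..}). \<bar>f \<eta>\<bar> \<le> B)"
proof (cases "graininess T t = 0")
  case True
  then have "continuous (at t within T \<inter> {t0..}) f"
    using f t by (auto simp: rd_continuous_on_def)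
  then have "(f \<longlongrightarrow> f t) (at t within T \<inter> {t0..})" by (simp add: continuous_within)
  then have "\<forall>\<^sub>F \<eta> in at t within T \<inter> {t0..}. dist (f \<eta>) (f t) < 1"
    by (rule tendstoD) simp
  then obtain U where "open U" "t \<in> U"
    and U: "\<And>\<eta>. \<eta> \<in> U \<Longrightarrow> \<eta> \<noteq> t \<Longrightarrow> \<eta> \<in> T \<inter> {t0..} \<Longrightarrow> dist (f \<eta>) (f t) < 1"
    unfolding eventually_at_topological by blast
  have "\<bar>f \<eta>\<bar> \<le> \<bar>f t\<bar> + 1" if "\<eta> \<in> U \<inter> (T \<inter> {t0..})" for \<eta>
    using U[of \<eta>] that by (cases "\<eta> = t") (auto simp: dist_real_def)
  with \<open>open U\<close> \<open>t \<in> U\<close> show ?thesis by blast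
next
  case False
  then have gap: "t < fwd_jump T t" using graininess_nonneg[of t] by (auto simp: graininess_def)
  have "\<exists>U B. open U \<and> t \<in> U \<and> (\<forall>\<eta>\<in>U \<inter> (T \<inter> {t0..}). \<eta> < t \<longrightarrow> \<bar>f \<eta>\<bar> \<le> B)"
  proof (cases "t islimpt (T \<inter> {t0..} \<inter> {..<t})")
    case True
    then obtain l where "(f \<longlongrightarrow> l) (at t within (T \<inter> {t0..} \<inter> {..<t}))"
      using f t by (auto simp: rd_continuous_on_def)
    then have "\<forall>\<^sub>F \<eta> in at t within (T \<inter> {t0..} \<inter> {..<t}). dist (f \<eta>) l < 1"
      by (rule tendstoD) simp
    then obtain U where "open U" "t \<in> U"
      and U: "\<And>\<eta>. \<eta> \<in> U \<Longrightarrow> \<eta> \<noteq> t \<Longrightarrow> \<eta> \<in> T \<inter> {t0..} \<inter> {..<t} \<Longrightarrow> dist (f \<eta>) l < 1"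
      unfolding eventually_at_topological by blast
    have "\<bar>f \<eta>\<bar> \<le> \<bar>l\<bar> + 1" if "\<eta> \<in> U \<inter> (T \<inter> {t0..})" "\<eta> < t" for \<eta>
      using U[of \<eta>] that by (auto simp: dist_real_def)
    with \<open>open U\<close> \<open>t \<in> U\<close> show ?thesis by blast
  next
    case False
    then obtain U where "t \<in> U" "open U" "\<And>y. y \<in> T \<inter> {t0..} \<inter> {..<t} \<Longrightarrow> y \<in> U \<Longrightarrow> y = t"
      unfolding islimpt_def by blast
    then show ?thesis by (intro exI[of _ U] exI[of _ 0]) force
  qed
  then obtain U B where U: "open U" "t \<in> U" "\<And>\<eta>. \<eta> \<in> U \<inter> (T \<inter> {t0..}) \<Longrightarrow> \<eta> < t \<Longrightarrow> \<bar>f \<eta>\<bar> \<le> B"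
    by blast
  \<comment> \<open>Cutting the neighbourhood at the forward jump leaves only \<open>t\<close>
    itself and points to its left.\<close>
  have "\<bar>f \<eta>\<bar> \<le> max B \<bar>f t\<bar>" if "\<eta> \<in> (U \<inter> {..<fwd_jump T t}) \<inter> (T \<inter> {t0..})" for \<eta>
    using U(3)[of \<eta>] that fwd_jump_le[of \<eta> t]
    by (cases \<eta> t rule: linorder_cases) (auto simp: le_max_iff_disj)
  then show ?thesis
    using U gap by (intro exI[of _ "U \<inter> {..<fwd_jump T t}"] exI[of _ "max B \<bar>f t\<bar>"]) auto
qed

text \<open>The local bounds are combined over a finite subcover of the compact set
  \<open>T \<inter> {t0..b}\<close>.\<close>

lemma rd_continuous_on_bounded:
  assumes f: "rd_continuous_on T (T \<inter> {t0..}) f"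
  shows "\<exists>B. \<forall>\<eta>\<in>T \<inter> {t0..b}. \<bar>f \<eta>\<bar> \<le> B"
proof -
  have comp: "compact (T \<inter> {t0..b})" using closed_T by (intro closed_Int_compact) auto
  have "\<forall>t\<in>T \<inter> {t0..b}. \<exists>U. open U \<and> t \<in> U \<and> (\<exists>B. \<forall>\<eta>\<in>U \<inter> (T \<inter> {t0..}). \<bar>f \<eta>\<bar> \<le> B)"
  proof
    fix t assume "t \<in> T \<inter> {t0..b}"
    then show "\<exists>U. open U \<and> t \<in> U \<and> (\<exists>B. \<forall>\<eta>\<in>U \<inter> (T \<inter> {t0..}). \<bar>f \<eta>\<bar> \<le> B)"
      using rd_continuous_on_locally_bounded[OF f, of t] by auto
  qed
  then obtain U where U: "\<And>t. t \<in> T \<inter> {t0..b} \<Longrightarrow> open (U t) \<and> t \<in> U t \<and> (\<exists>B. \<forall>\<eta>\<in>U t \<inter> (T \<inter> {t0..}). \<bar>f \<eta>\<bar> \<le> B)"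
    by metis
  have "\<And>t. t \<in> T \<inter> {t0..b} \<Longrightarrow> open (U t)" "T \<inter> {t0..b} \<subseteq> (\<Union>t\<in>T \<inter> {t0..b}. U t)"
    using U by blast+
  then obtain F where F: "F \<subseteq> T \<inter> {t0..b}" "finite F" "T \<inter> {t0..b} \<subseteq> (\<Union>t\<in>F. U t)"
    by (rule compactE_image[OF comp])
  obtain B where B: "\<And>t \<eta>. t \<in> T \<inter> {t0..b} \<Longrightarrow> \<eta> \<in> U t \<inter> (T \<inter> {t0..}) \<Longrightarrow> \<bar>f \<eta>\<bar> \<le> B t"
    using U by metis
  have "\<bar>f \<eta>\<bar> \<le> (\<Sum>t\<in>F. \<bar>B t\<bar>)" if \<eta>: "\<eta> \<in> T \<inter> {t0..b}" for \<eta>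
  proof -
    obtain t where t: "t \<in> F" "\<eta> \<in> U t" using F(3) \<eta> by blast
    then have "t \<in> T \<inter> {t0..b}" using F(1) by blast
    then have "\<bar>f \<eta>\<bar> \<le> B t" using B[of t \<eta>] t \<eta> by auto
    also have "\<dots> \<le> (\<Sum>t\<in>F. \<bar>B t\<bar>)"
      using member_le_sum[OF t(1), of "\<lambda>t. \<bar>B t\<bar>"] F by auto
    finally show ?thesis .
  qed
  then show ?thesis by blast
qed

text \<open>Off the countable set of right-scattered points the function is continuous, and altering
  a function on a countable set preserves Borel measurability.\<close>

lemma rd_continuous_on_measurable:
  assumes f: "rd_continuous_on T (T \<inter> {t0..}) f"
  shows "set_borel_measurable borel (T \<inter> {t0..}) f"
proof -
  define S where "S = {r \<in> T. r < fwd_jump T r}"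
  have "countable S" unfolding S_def by (rule countable_right_scattered)
  then have [measurable]: "S \<in> sets borel"
    by (rule sets.countable[rotated]) auto
  have "continuous_on (T \<inter> {t0..} - S) f"
    unfolding continuous_on_eq_continuous_within
  proof
    fix t assume t: "t \<in> T \<inter> {t0..} - S"
    then have "graininess T t = 0"
      using fwd_jump_ge[of t] by (auto simp: S_def graininess_def)
    then have "continuous (at t within T \<inter> {t0..}) f"
      using f t by (auto simp: rd_continuous_on_def)
    then show "continuous (at t within T \<inter> {t0..} - S) f"
      by (rule continuous_within_subset) auto
  qed
  then have "(\<lambda>\<eta>. indicator (T \<inter> {t0..} - S) \<eta> *\<^sub>R f \<eta>) \<in> borel_measurable borel"
    by (intro borel_measurable_continuous_on_indicator) auto
  then show ?thesis
    unfolding set_borel_measurable_def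
    by (rule measurable_discrete_difference[OF _ \<open>countable S\<close>]) (auto split: split_indicator)
qed

lemma integral_gap:
  assumes "r \<in> T" "c \<le> r"
  shows "integral {r..fwd_jump T r} (\<lambda>u. f (ts_floor u)) = graininess T r * (f r :: real)"
proof -
  have "integral {r..fwd_jump T r} (\<lambda>u. f (ts_floor u)) = integral {r..fwd_jump T r} (\<lambda>u. f r)"
    by (rule integral_spike[of "{fwd_jump T r}"]) (use assms ts_floor_eq in auto)
  then show ?thesis using fwd_jump_ge[of r] by (simp add: graininess_def)
qed

lemma borel_measurable_graininess [measurable]: "graininess T \<in> borel_measurable borel"
proof -
  have [measurable]: "fwd_jump T \<in> borel_measurable borel"
    by (intro borel_measurable_mono monoI fwd_jump_mono)
  show ?thesis unfolding graininess_def[abs_def] by measurable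
qed

end

section \<open>The decaying weight and its dynamic equation\<close>

locale decay_weight = unbounded_time_scale +
  fixes A :: "real \<Rightarrow> real" and lam :: real
  assumes adm_A: "admissible A"
    and A_nonneg: "\<eta> \<in> T \<Longrightarrow> c \<le> \<eta> \<Longrightarrow> 0 \<le> A \<eta>"
    and lam_pos: "0 < lam"
begin

definition rate :: "real \<Rightarrow> real" where
  "rate u = A (ts_floor u)"

definition log_rate :: "real \<Rightarrow> real" where
  "log_rate u = cylinder (graininess T (ts_floor u)) (lam * A (ts_floor u))"

text \<open>At points of \<open>T\<close> from \<open>c\<close> on, this is the reciprocal of the
  exponential function of \<open>lam * A\<close> started at \<open>c\<close>. It extends
  continuously to the whole line, with value 1 below \<open>c\<close>.\<close>

definition decay :: "real \<Rightarrow> real" where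
  "decay u = exp (- integral {c..u} log_rate)"

lemma rate_nonneg: "0 \<le> rate u"
  using A_nonneg ts_floor_in_T ts_floor_ge by (simp add: rate_def)

lemma log_rate_nonneg: "0 \<le> log_rate u"
  using A_nonneg ts_floor_in_T ts_floor_ge graininess_nonneg lam_pos
  by (auto simp: log_rate_def intro!: cylinder_nonneg)

lemma log_rate_le: "log_rate u \<le> lam * rate u"
  using A_nonneg ts_floor_in_T ts_floor_ge graininess_nonneg lam_pos
  by (auto simp: log_rate_def rate_def intro!: cylinder_le)

lemma rate_lb: "locally_bounded_borel rate"
  unfolding rate_def using adm_A by (rule admissible_locally_bounded_borel)

lemma adm_log_rate: "admissible (\<lambda>\<eta>. cylinder (graininess T \<eta>) (lam * A \<eta>))"
  unfolding admissible_def
proof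
  have [measurable]: "(\<lambda>\<eta>. indicator (T \<inter> {c..}) \<eta> * A \<eta>) \<in> borel_measurable borel"
    using adm_A by (simp add: admissible_def set_borel_measurable_def)
  \<comment> \<open>\<open>A\<close> is measurable only after restriction, so the indicator is also
    placed inside \<open>cylinder\<close>.\<close>
  have "(\<lambda>\<eta>. indicator (T \<inter> {c..}) \<eta> * cylinder (graininess T \<eta>) (lam * (indicator (T \<inter> {c..}) \<eta> * A \<eta>)))
    \<in> borel_measurable borel" by measurable
  then show "set_borel_measurable borel (T \<inter> {c..}) (\<lambda>\<eta>. cylinder (graininess T \<eta>) (lam * A \<eta>))"
    unfolding set_borel_measurable_def
    by (rule measurable_cong[THEN iffD1, rotated]) (auto split: split_indicator)
  show "\<forall>b. \<exists>B. \<forall>\<eta>\<in>T \<inter> {c..b}. \<bar>cylinder (graininess T \<eta>) (lam * A \<eta>)\<bar> \<le> B"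
  proof
    fix b
    obtain B where B: "\<And>\<eta>. \<eta> \<in> T \<inter> {c..b} \<Longrightarrow> \<bar>A \<eta>\<bar> \<le> B"
      using adm_A unfolding admissible_def by meson
    have "\<bar>cylinder (graininess T \<eta>) (lam * A \<eta>)\<bar> \<le> lam * B" if "\<eta> \<in> T \<inter> {c..b}" for \<eta>
    proof -
      have "0 \<le> A \<eta>" "A \<eta> \<le> B" using A_nonneg B[OF that] that by auto
      then have "lam * A \<eta> \<le> lam * B" "0 \<le> lam * A \<eta>" using lam_pos by auto
      then show ?thesis
        using cylinder_nonneg[OF graininess_nonneg[of \<eta>], of "lam * A \<eta>"]
          cylinder_le[OF graininess_nonneg[of \<eta>], of "lam * A \<eta>"] by linarith
    qed
    then show "\<exists>B. \<forall>\<eta>\<in>T \<inter> {c..b}. \<bar>cylinder (graininess T \<eta>) (lam * A \<eta>)\<bar> \<le> B" by blast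
  qed
qed

lemma log_rate_lb: "locally_bounded_borel log_rate"
  unfolding log_rate_def using adm_log_rate by (rule admissible_locally_bounded_borel)

lemma decay_pos: "0 < decay u"
  by (simp add: decay_def)

lemma log_rate_integral_nonneg: "0 \<le> integral {s..t} log_rate"
  using log_rate_nonneg log_rate_lb locally_bounded_borel_integrable_on
  by (intro Henstock_Kurzweil_Integration.integral_nonneg) auto

lemma decay_antimono:
  assumes "u \<le> v"
  shows "decay v \<le> decay u"
proof (cases "c \<le> u")
  case True
  then show ?thesis
    using integral_diff[OF log_rate_lb True assms] log_rate_integral_nonneg[of u v] by (simp add: decay_def)
next
  case False
  then show ?thesis using log_rate_integral_nonneg[of c v] by (simp add: decay_def)
qed

lemma decay_le_1: "decay u \<le> 1"
  using log_rate_integral_nonneg by (simp add: decay_def)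

lemma decay_ratio:
  assumes "c \<le> s" "s \<le> t"
  shows "decay t / decay s = exp (- integral {s..t} log_rate)"
  using integral_diff[OF log_rate_lb assms] by (simp add: decay_def flip: exp_diff)

lemma ts_exp_rate:
  assumes "s \<in> T" "t \<in> T" "c \<le> s" "s \<le> t"
  shows "ts_exp T (\<lambda>r. lam * A r) t s = decay s / decay t"
proof -
  have "ts_exp T (\<lambda>r. lam * A r) t s = exp (integral {s..t} log_rate)"
    using delta_integral_eq_integral[OF adm_log_rate assms] by (simp add: ts_exp_def log_rate_def[abs_def])
  also have "\<dots> = inverse (decay t / decay s)"
    using assms by (simp add: decay_ratio exp_minus)
  finally show ?thesis by simp
qed

lemma ts_exp_ominus_rate:
  assumes "s \<in> T" "t \<in> T" "c \<le> s" "s \<le> t"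
  shows "ts_exp T (ominus T (\<lambda>r. lam * A r)) t s = decay t / decay s"
proof -
  have adm: "admissible (\<lambda>\<eta>. - cylinder (graininess T \<eta>) (lam * A \<eta>))"
    using adm_log_rate by (simp add: admissible_def set_borel_measurable_def)
  have "delta_integral T s t (\<lambda>\<eta>. cylinder (graininess T \<eta>) (ominus T (\<lambda>r. lam * A r) \<eta>))
    = delta_integral T s t (\<lambda>\<eta>. - cylinder (graininess T \<eta>) (lam * A \<eta>))"
    using assms lam_pos A_nonneg
    by (intro delta_integral_cong cylinder_ominus[OF graininess_nonneg]) auto
  also have "\<dots> = - integral {s..t} log_rate"
    using delta_integral_eq_integral[OF adm assms] by (simp add: log_rate_def[abs_def])
  finally show ?thesis using assms by (simp add: ts_exp_def decay_ratio)
qed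

text \<open>Over the gap at \<open>r\<close> the integral of \<open>log_rate\<close> is the
  logarithm of \<open>1 + lam * A r * graininess T r\<close>. This is the equation
  \<open>E\<^sup>\<Delta> = - lam A E\<^sup>\<sigma>\<close> across a single gap.\<close>

lemma decay_fwd_jump:
  assumes "r \<in> T" "c \<le> r"
  shows "decay (fwd_jump T r) * (1 + lam * A r * graininess T r) = decay r"
proof (cases "graininess T r = 0")
  case True
  then show ?thesis by (simp add: graininess_def)
next
  case False
  have pos: "0 < 1 + graininess T r * (lam * A r)"
    using A_nonneg[OF assms] graininess_nonneg[of r] lam_pos by (simp add: add_pos_nonneg)
  have "integral {r..fwd_jump T r} log_rate = ln (1 + graininess T r * (lam * A r))"
    unfolding log_rate_def[abs_def] using integral_gap[OF assms, of "\<lambda>\<eta>. cylinder (graininess T \<eta>) (lam * A \<eta>)"] False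
    by (simp add: cylinder_def)
  then have "decay (fwd_jump T r) / decay r = inverse (1 + graininess T r * (lam * A r))"
    using pos assms fwd_jump_ge by (simp add: decay_ratio exp_minus)
  then show ?thesis
    using pos decay_pos[of r] by (simp add: field_simps)
qed

lemma decay_lb: "locally_bounded_borel decay"
  unfolding decay_def
  by (intro locally_bounded_borel_continuous continuous_on_exp continuous_on_minus
    continuous_indefinite_integral log_rate_lb)

lemma rate_decay_lb: "locally_bounded_borel (\<lambda>u. rate u * decay (fwd_jump T (ts_floor u)))"
proof (intro locally_bounded_borel_mult rate_lb)
  \<comment> \<open>The weight decreases, so the rule for increasing functions is applied to its
    negative.\<close>
  have "mono (\<lambda>u. - decay (fwd_jump T (ts_floor u)))"
    using ts_floor_mono by (intro monoI) (auto intro!: decay_antimono fwd_jump_mono simp: mono_def)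
  from locally_bounded_borel_mult[OF locally_bounded_borel_const[of "-1"] locally_bounded_borel_mono[OF this]]
  show "locally_bounded_borel (\<lambda>u. decay (fwd_jump T (ts_floor u)))" by simp
qed

text \<open>The two integrands differ pointwise, but their integrals over every gap agree.\<close>

lemma decay_diff:
  assumes "s \<in> T" "t \<in> T" "c \<le> s" "s \<le> t"
  shows "decay s - decay t = lam * integral {s..t} (\<lambda>u. rate u * decay (fwd_jump T (ts_floor u)))"
proof -
  let ?g = "\<lambda>u. rate u * decay (fwd_jump T (ts_floor u))"
  have exp_eq: "integral {u..v} (\<lambda>w. log_rate w * decay w) = decay u - decay v" if "c \<le> u" "u \<le> v" for u v
  proof -
    have "locally_bounded_borel (\<lambda>u. (-1) * log_rate u)"
      by (intro locally_bounded_borel_intros log_rate_lb)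
    from exp_integral_diff[OF this that] show ?thesis
      by (simp add: decay_def)
  qed
  have ld: "locally_bounded_borel (\<lambda>u. log_rate u * decay u)"
    by (intro locally_bounded_borel_mult log_rate_lb decay_lb)
  have mg: "locally_bounded_borel (\<lambda>u. (- lam) * ?g u)"
    by (intro locally_bounded_borel_mult locally_bounded_borel_const rate_decay_lb[unfolded mult.assoc])
  have split: "integral {u..v} (\<lambda>w. log_rate w * decay w + (- lam) * ?g w)
    = decay u - decay v - lam * integral {u..v} ?g" if "c \<le> u" "u \<le> v" for u v
    using Henstock_Kurzweil_Integration.integral_add[OF locally_bounded_borel_integrable_on[OF ld, of u v]
        locally_bounded_borel_integrable_on[OF mg, of u v]] exp_eq[OF that]
    by (simp del: mult_minus_left)
  \<comment> \<open>At right-dense points \<open>cylinder 0\<close> is the identity and the two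
    terms cancel; over a gap they cancel after integration by \<open>decay_fwd_jump\<close>.\<close>
  have "integral {s..t} (\<lambda>w. log_rate w * decay w + (- lam) * ?g w) = 0"
  proof (rule integral_eq_zero_if_gapwise[OF locally_bounded_borel_add[OF ld mg] assms(1-3)])
    fix u assume "u \<in> T" "s \<le> u" "fwd_jump T u = u"
    then show "log_rate u * decay u + (- lam) * ?g u = 0"
      using assms by (simp add: log_rate_def rate_def ts_floor_eq_self graininess_def cylinder_def)
  next
    fix r assume r: "r \<in> T" "s \<le> r"
    have "integral {r..fwd_jump T r} ?g = graininess T r * (A r * decay (fwd_jump T r))"
      unfolding rate_def using r assms
      by (intro integral_gap[of r "\<lambda>\<eta>. A \<eta> * decay (fwd_jump T \<eta>)"]) auto
    then show "integral {r..fwd_jump T r} (\<lambda>w. log_rate w * decay w + (- lam) * ?g w) = 0"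
      using split[of r "fwd_jump T r"] decay_fwd_jump[of r] r assms fwd_jump_ge[of r]
      by (simp add: algebra_simps)
  qed
  then show ?thesis using split[of s t] assms by simp
qed

end

section \<open>Gronwall inequalities and delay functions\<close>

text \<open>This replaces a first-crossing argument and needs no continuity of \<open>f\<close>.
  Were the supremum \<open>K\<close> greater than \<open>N\<close>, \<open>contract\<close> would
  give an upper bound strictly below it.\<close>

lemma le_if_contracting_upper_bound:
  fixes f :: "'a \<Rightarrow> real"
  assumes "x \<in> X" "bdd_above (f ` X)" "0 < \<theta>"
    and contract: "\<And>K y. N \<le> K \<Longrightarrow> (\<And>z. z \<in> X \<Longrightarrow> f z \<le> K) \<Longrightarrow> y \<in> X \<Longrightarrow> f y \<le> K - (K - N) * \<theta>"
  shows "f x \<le> N"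
proof (rule ccontr)
  assume "\<not> f x \<le> N"
  define K where "K = (SUP y\<in>X. f y)"
  have K: "f y \<le> K" if "y \<in> X" for y
    unfolding K_def using that assms(2) by (rule cSUP_upper)
  then have "N < K" using \<open>\<not> f x \<le> N\<close> \<open>x \<in> X\<close> by force
  have "K \<le> K - (K - N) * \<theta>"
    by (subst K_def, rule cSUP_least) (use contract[of K] K \<open>N < K\<close> \<open>x \<in> X\<close> in auto)
  moreover have "0 < (K - N) * \<theta>" using \<open>N < K\<close> \<open>0 < \<theta>\<close> by simp
  ultimately show False by simp
qed

lemma integral_exp_decreasing:
  fixes k :: real
  assumes "a \<le> b"
  shows "integral {a..b} (\<lambda>v. k * exp (k * (b - v))) = exp (k * (b - a)) - 1"
proof -
  have "((\<lambda>v. k * exp (k * (b - v))) has_integral ((- exp (k * (b - b))) - (- exp (k * (b - a))))) {a..b}"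
    using assms
    by (intro fundamental_theorem_of_calculus)
      (auto intro!: derivative_eq_intros simp: has_real_derivative_iff_has_vector_derivative[symmetric])
  from integral_unique[OF this] show ?thesis by simp
qed

text \<open>Endpoints have measure zero, and the estimates through floors and jumps are stated for
  interior points only.\<close>

lemma integral_mono_open_interval:
  assumes "locally_bounded_borel f" "locally_bounded_borel g"
    and "\<And>u. a < u \<Longrightarrow> u < b \<Longrightarrow> f u \<le> g u"
  shows "integral {a..b} f \<le> integral {a..b} g"
proof -
  have "integral {a<..<b} f \<le> integral {a<..<b} g"
    using assms locally_bounded_borel_integrable_on
    by (intro integral_le) (auto simp: integrable_on_open_interval_real)
  then show ?thesis by (simp add: integral_open_interval_real)
qed

section \<open>The backward Gronwall inequality\<close>

context unbounded_time_scale
begin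

text \<open>Since \<open>w\<close> is controlled through its value at the forward jump, Gronwall's argument runs
  backwards in time.\<close>

lemma backward_gronwall:
  assumes sb: "s \<in> T" "b \<in> T" "c \<le> s" "s \<le> b" and "0 \<le> k" and e: "locally_bounded_borel e"
    and diff: "\<And>t. t \<in> T \<Longrightarrow> s \<le> t \<Longrightarrow> t \<le> b \<Longrightarrow> w t - w b = integral {t..b} e"
    and e_le: "\<And>v. s < v \<Longrightarrow> v < b \<Longrightarrow> e v \<le> k * w (fwd_jump T (ts_floor v))"
    and w_nonneg: "0 \<le> w b"
  shows "w s \<le> w b * exp (k * (b - s))"
proof -
  \<comment> \<open>With the expected growth divided out, the claim becomes
    \<open>f s \<le> w b\<close>. The contraction factor used below is the least value of the
    exponential on \<open>{s..b}\<close>.\<close>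
  define f where "f t = w t * exp (- (k * (b - t)))" for t
  obtain B where "B \<ge> 0" and B: "\<And>u. u \<in> {s..b} \<Longrightarrow> \<bar>e u\<bar> \<le> B"
    using locally_bounded_borelE[OF e] by metis
  have "f s \<le> w b"
  proof (rule le_if_contracting_upper_bound[where X = "T \<inter> {s..b}" and f = f and \<theta> = "exp (- (k * (b - s)))"])
    show "bdd_above (f ` (T \<inter> {s..b}))"
    proof (rule bdd_aboveI2)
      fix t assume t: "t \<in> T \<inter> {s..b}"
      have "w t \<le> w b + B * (b - t)"
        using diff[of t] abs_integral_le[OF e, of t b B] B t by auto
      also have "\<dots> \<le> w b + B * (b - s)" using \<open>B \<ge> 0\<close> t by (intro add_left_mono mult_left_mono) auto
      finally have "f t \<le> (w b + B * (b - s)) * exp (- (k * (b - t)))"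
        unfolding f_def by (intro mult_right_mono) auto
      also have "\<dots> \<le> (w b + B * (b - s)) * 1"
        using \<open>0 \<le> k\<close> t w_nonneg \<open>B \<ge> 0\<close> sb by (intro mult_left_mono) auto
      finally show "f t \<le> w b + B * (b - s)" by simp
    qed
  next
    fix m t assume m: "w b \<le> m" "\<And>z. z \<in> T \<inter> {s..b} \<Longrightarrow> f z \<le> m" and t: "t \<in> T \<inter> {s..b}"
    have w_le: "w z \<le> m * exp (k * (b - z))" if "z \<in> T \<inter> {s..b}" for z
      using mult_right_mono[OF m(2)[OF that], of "exp (k * (b - z))"]
      by (simp add: f_def mult.assoc flip: exp_add)
    have exp_lb: "locally_bounded_borel (\<lambda>v. m * (k * exp (k * (b - v))))"
      by (intro locally_bounded_borel_continuous continuous_intros)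
    have "integral {t..b} e \<le> integral {t..b} (\<lambda>v. m * (k * exp (k * (b - v))))"
    proof (rule integral_mono_open_interval[OF e exp_lb])
      fix v assume v: "t < v" "v < b"
      let ?j = "fwd_jump T (ts_floor v)"
      have j: "?j \<in> T \<inter> {s..b}" "v \<le> ?j"
        using fwd_jump_ts_floor_le[of b v] le_fwd_jump_ts_floor[of v] fwd_jump_in_T v t sb by auto
      have "e v \<le> k * w ?j" using e_le v t by auto
      also have "\<dots> \<le> k * (m * exp (k * (b - ?j)))"
        using w_le[OF j(1)] \<open>0 \<le> k\<close> by (intro mult_left_mono) auto
      \<comment> \<open>The jump lies at or after \<open>v\<close>, so the exponent grows;
        \<open>m\<close> is nonnegative because \<open>0 \<le> w b \<le> m\<close>.\<close>
      also have "\<dots> \<le> k * (m * exp (k * (b - v)))"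
        using \<open>0 \<le> k\<close> j m(1) w_nonneg by (intro mult_left_mono) (auto intro!: mult_left_mono)
      finally show "e v \<le> m * (k * exp (k * (b - v)))" by (simp add: mult_ac)
    qed
    also have "\<dots> = m * (exp (k * (b - t)) - 1)"
      using integral_exp_decreasing[of t b k] t by simp
    finally have "w t \<le> w b + m * (exp (k * (b - t)) - 1)" using diff[of t] t by auto
    then have "f t \<le> (w b + m * (exp (k * (b - t)) - 1)) * exp (- (k * (b - t)))"
      unfolding f_def by (intro mult_right_mono) auto
    also have "\<dots> = m - (m - w b) * exp (- (k * (b - t)))"
      by (simp add: algebra_simps flip: exp_add)
    also have "\<dots> \<le> m - (m - w b) * exp (- (k * (b - s)))"
    proof -
      have "k * (b - t) \<le> k * (b - s)" using \<open>0 \<le> k\<close> t by (intro mult_left_mono) auto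
      then show ?thesis using m(1) by (intro diff_left_mono mult_left_mono) auto
    qed
    finally show "f t \<le> m - (m - w b) * exp (- (k * (b - s)))" .
  qed (use sb in auto)
  then have "f s * exp (k * (b - s)) \<le> w b * exp (k * (b - s))" by (rule mult_right_mono) simp
  then show ?thesis by (simp add: f_def mult.assoc flip: exp_add)
qed

lemma admissible_mult:
  assumes f: "admissible f" and g: "locally_bounded_borel g"
  shows "admissible (\<lambda>\<eta>. f \<eta> * g \<eta>)"
  unfolding admissible_def
proof
  have [measurable]: "(\<lambda>\<eta>. indicator (T \<inter> {c..}) \<eta> *\<^sub>R f \<eta>) \<in> borel_measurable borel"
    using f by (simp add: admissible_def set_borel_measurable_def)
  have "(\<lambda>\<eta>. (indicator (T \<inter> {c..}) \<eta> *\<^sub>R f \<eta>) * g \<eta>) \<in> borel_measurable borel"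
    using g by measurable
  then show "set_borel_measurable borel (T \<inter> {c..}) (\<lambda>\<eta>. f \<eta> * g \<eta>)"
    by (simp add: set_borel_measurable_def mult.assoc)
  show "\<forall>b. \<exists>B. \<forall>\<eta>\<in>T \<inter> {c..b}. \<bar>f \<eta> * g \<eta>\<bar> \<le> B"
  proof
    fix b
    obtain B where B: "\<And>\<eta>. \<eta> \<in> T \<inter> {c..b} \<Longrightarrow> \<bar>f \<eta>\<bar> \<le> B"
      using f unfolding admissible_def by meson
    obtain C where C: "0 \<le> C" "\<And>u. u \<in> {c..b} \<Longrightarrow> \<bar>g u\<bar> \<le> C"
      using locally_bounded_borelE[OF g] by metis
    have "\<bar>f \<eta> * g \<eta>\<bar> \<le> \<bar>B\<bar> * C" if "\<eta> \<in> T \<inter> {c..b}" for \<eta>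
      unfolding abs_mult using B[OF that] C(2)[of \<eta>] that by (intro mult_mono) auto
    then show "\<exists>B. \<forall>\<eta>\<in>T \<inter> {c..b}. \<bar>f \<eta> * g \<eta>\<bar> \<le> B" by blast
  qed
qed

end

section \<open>Delay functions\<close>

locale delay_function = unbounded_time_scale T t0 for T :: "real set" and t0 :: real +
  fixes \<alpha> :: "real \<Rightarrow> real"
  assumes delay_in_T: "\<eta> \<in> T \<Longrightarrow> t0 \<le> \<eta> \<Longrightarrow> \<alpha> \<eta> \<in> T"
    and delay_rd: "rd_continuous_on T (T \<inter> {t0..}) \<alpha>"
    and delay_at_top: "filterlim \<alpha> at_top (inf at_top (principal (T \<inter> {t0..})))"
    and delay_le: "\<eta> \<in> T \<Longrightarrow> t0 \<le> \<eta> \<Longrightarrow> \<alpha> \<eta> \<le> \<eta>"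
begin

lemma delay_eventually_ge: "\<exists>n\<ge>t0. \<forall>\<eta>\<in>T. n \<le> \<eta> \<longrightarrow> z \<le> \<alpha> \<eta>"
proof -
  have "\<forall>\<^sub>F \<eta> in at_top. \<eta> \<in> T \<inter> {t0..} \<longrightarrow> z \<le> \<alpha> \<eta>"
    using delay_at_top unfolding filterlim_at_top eventually_inf_principal by blast
  then obtain n where "\<And>\<eta>. n \<le> \<eta> \<Longrightarrow> \<eta> \<in> T \<inter> {t0..} \<longrightarrow> z \<le> \<alpha> \<eta>"
    unfolding eventually_at_top_linorder by blast
  then show ?thesis by (intro exI[of _ "max n t0"]) auto
qed

text \<open>The limit at infinity bounds the tail, and rd-continuity bounds the remaining compact
  piece. This makes the infimum in \<open>delay_low\<close> meaningful.\<close>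

lemma delay_bdd_below:
  assumes "t0 \<le> t"
  shows "bdd_below (\<alpha> ` (T \<inter> {t..}))"
proof -
  obtain n where n: "\<And>\<eta>. \<eta> \<in> T \<Longrightarrow> n \<le> \<eta> \<Longrightarrow> 0 \<le> \<alpha> \<eta>"
    using delay_eventually_ge[of 0] by blast
  obtain B where B: "\<And>\<eta>. \<eta> \<in> T \<inter> {t0..n} \<Longrightarrow> \<bar>\<alpha> \<eta>\<bar> \<le> B"
    using rd_continuous_on_bounded[OF delay_rd] by metis
  show ?thesis
  proof (rule bdd_belowI2)
    fix \<eta> assume "\<eta> \<in> T \<inter> {t..}"
    then show "- \<bar>B\<bar> \<le> \<alpha> \<eta>" using n[of \<eta>] B[of \<eta>] assms by (cases "n \<le> \<eta>") auto
  qed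
qed

lemma T_above_nonempty: "T \<inter> {t..} \<noteq> {}"
  using T_above[of t] by auto

lemma delay_low_le:
  "t0 \<le> t \<Longrightarrow> t \<le> \<eta> \<Longrightarrow> \<eta> \<in> T \<Longrightarrow> delay_low T \<alpha> t \<le> \<alpha> \<eta>"
  unfolding delay_low_def by (rule cINF_lower[OF delay_bdd_below]) auto

lemma delay_low_mono: "t0 \<le> t \<Longrightarrow> t \<le> u \<Longrightarrow> delay_low T \<alpha> t \<le> delay_low T \<alpha> u"
  unfolding delay_low_def using T_above_nonempty
  by (intro cINF_superset_mono delay_bdd_below) auto

lemma delay_low_in_T:
  assumes "t0 \<le> t"
  shows "delay_low T \<alpha> t \<in> T"
proof -
  have "delay_low T \<alpha> t \<in> closure (\<alpha> ` (T \<inter> {t..}))"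
    unfolding delay_low_def
    using T_above_nonempty delay_bdd_below[OF assms] by (intro closure_contains_Inf) auto
  moreover have "closure (\<alpha> ` (T \<inter> {t..})) \<subseteq> T"
    using assms delay_in_T closed_T by (intro closure_minimal) auto
  ultimately show ?thesis by blast
qed

lemma delay_low_le_self: "t \<in> T \<Longrightarrow> t0 \<le> t \<Longrightarrow> delay_low T \<alpha> t \<le> t"
  using delay_low_le[of t t] delay_le[of t] by linarith

text \<open>Once \<alpha> stays above \<open>s + 1\<close>, so does its infimum over later times;
  the margin 1 contradicts \<open>delay_low T \<alpha> \<eta> \<le> s\<close>.\<close>

lemma delay_inv_bdd_above: "bdd_above {\<eta> \<in> T \<inter> {t0..}. delay_low T \<alpha> \<eta> \<le> s}"
proof -
  obtain n where n: "t0 \<le> n" "\<And>\<eta>. \<eta> \<in> T \<Longrightarrow> n \<le> \<eta> \<Longrightarrow> s + 1 \<le> \<alpha> \<eta>"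
    using delay_eventually_ge[of "s + 1"] by blast
  have "\<eta> \<le> n" if "\<eta> \<in> T" "t0 \<le> \<eta>" "delay_low T \<alpha> \<eta> \<le> s" for \<eta>
  proof (rule ccontr)
    assume "\<not> \<eta> \<le> n"
    then have "s + 1 \<le> delay_low T \<alpha> \<eta>"
      unfolding delay_low_def using T_above_nonempty n by (intro cINF_greatest) auto
    then show False using that by simp
  qed
  then show ?thesis by (intro bdd_aboveI[of _ n]) auto
qed

lemma delay_inv_in_T: "s \<in> T \<Longrightarrow> t0 \<le> s \<Longrightarrow> delay_inv T t0 \<alpha> s \<in> T"
  and delay_inv_ge: "s \<in> T \<Longrightarrow> t0 \<le> s \<Longrightarrow> s \<le> delay_inv T t0 \<alpha> s"
proof -
  assume s: "s \<in> T" "t0 \<le> s"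
  then have mem: "s \<in> {\<eta> \<in> T \<inter> {t0..}. delay_low T \<alpha> \<eta> \<le> s}" using delay_low_le_self by auto
  then show "s \<le> delay_inv T t0 \<alpha> s"
    unfolding delay_inv_def using delay_inv_bdd_above by (rule cSup_upper)
  have "delay_inv T t0 \<alpha> s \<in> closure {\<eta> \<in> T \<inter> {t0..}. delay_low T \<alpha> \<eta> \<le> s}"
    unfolding delay_inv_def using mem delay_inv_bdd_above by (intro closure_contains_Sup) auto
  moreover have "closure {\<eta> \<in> T \<inter> {t0..}. delay_low T \<alpha> \<eta> \<le> s} \<subseteq> T"
    using closed_T by (intro closure_minimal) auto
  ultimately show "delay_inv T t0 \<alpha> s \<in> T" by blast
qed

text \<open>After \<open>delay_inv T t0 \<alpha> s\<close> the delay window no longer reaches the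
  initial data, so the equation itself can be integrated over it.\<close>

lemma delay_low_gt_if_gt_delay_inv:
  assumes "\<eta> \<in> T" "t0 \<le> \<eta>" "delay_inv T t0 \<alpha> s < \<eta>"
  shows "s < delay_low T \<alpha> \<eta>"
proof (rule ccontr)
  assume "\<not> ?thesis"
  then have "\<eta> \<le> delay_inv T t0 \<alpha> s"
    unfolding delay_inv_def using assms delay_inv_bdd_above by (intro cSup_upper) auto
  then show False using assms by simp
qed

end

section \<open>Solutions of the delay equation\<close>

lemma abs_le_history_norm:
  assumes "initial_function T \<alpha> s \<phi>" "r \<in> history_dom T \<alpha> s"
  shows "\<bar>\<phi> r\<bar> \<le> history_norm T \<alpha> s \<phi>"
proof -
  obtain B where "\<And>y. y \<in> history_dom T \<alpha> s \<Longrightarrow> \<bar>\<phi> y\<bar> \<le> B"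
    using assms(1) by (auto simp: initial_function_def bounded_iff)
  then have "\<bar>\<phi> r\<bar> \<le> (SUP \<eta>\<in>history_dom T \<alpha> s. \<bar>\<phi> \<eta>\<bar>)"
    using assms(2) by (intro cSUP_upper bdd_aboveI2) auto
  then show ?thesis using assms(2) by (auto simp: history_norm_def)
qed

lemma history_norm_nonneg:
  assumes "initial_function T \<alpha> s \<phi>"
  shows "0 \<le> history_norm T \<alpha> s \<phi>"
proof (cases "history_dom T \<alpha> s = {}")
  case False
  then obtain r where "r \<in> history_dom T \<alpha> s" by auto
  from abs_le_history_norm[OF assms this] show ?thesis by linarith
qed (simp add: history_norm_def)

text \<open>Real unordered sums converge absolutely, so integrability up to \<open>b\<close> yields
  one bound, formed with \<open>\<bar>f\<bar>\<close>, for all shorter intervals. It gives the a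
  priori boundedness of solutions.\<close>

lemma delta_integral_bounded:
  assumes T: "T \<in> sets borel" and "delta_integrable T s b f"
  shows "\<exists>B. \<forall>t. s \<le> t \<longrightarrow> t \<le> b \<longrightarrow> \<bar>delta_integral T s t f\<bar> \<le> B"
proof -
  let ?m = "\<lambda>\<eta>. graininess T \<eta> * f \<eta>"
  have sum: "(\<lambda>\<eta>. \<bar>?m \<eta>\<bar>) summable_on scattered_in T s b"
    using assms summable_on_iff_abs_summable_on_real by (fastforce simp: delta_integrable_def)
  have int: "set_integrable lborel (T \<inter> {s..<b}) f" using assms by (simp add: delta_integrable_def)
  have bound: "\<bar>delta_integral T s t f\<bar>
      \<le> (LINT \<eta>:T \<inter> {s..<b}|lborel. \<bar>f \<eta>\<bar>) + infsum (\<lambda>\<eta>. \<bar>?m \<eta>\<bar>) (scattered_in T s b)"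
    if t: "s \<le> t" "t \<le> b" for t
  proof -
    have sub: "scattered_in T s t \<subseteq> scattered_in T s b" using t by (auto simp: scattered_in_def)
    note sum_t = summable_on_subset_banach[OF sum sub]
    have "\<bar>infsum ?m (scattered_in T s t)\<bar> \<le> infsum (\<lambda>\<eta>. \<bar>?m \<eta>\<bar>) (scattered_in T s t)"
      using norm_infsum_bound[of ?m "scattered_in T s t"] sum_t by simp
    also have "\<dots> \<le> infsum (\<lambda>\<eta>. \<bar>?m \<eta>\<bar>) (scattered_in T s b)"
      using sum sum_t sub by (intro infsum_mono_neutral) auto
    finally have 1: "\<bar>infsum ?m (scattered_in T s t)\<bar> \<le> infsum (\<lambda>\<eta>. \<bar>?m \<eta>\<bar>) (scattered_in T s b)" .
    have "\<bar>LINT \<eta>:T \<inter> {s..<t}|lborel. f \<eta>\<bar> \<le> (LINT \<eta>:T \<inter> {s..<b}|lborel. \<bar>f \<eta>\<bar>)"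
    proof -
      have int_t: "set_integrable lborel (T \<inter> {s..<t}) f"
        using T t by (intro set_integrable_subset[OF int]) auto
      have "\<bar>LINT \<eta>:T \<inter> {s..<t}|lborel. f \<eta>\<bar> \<le> (LINT \<eta>:T \<inter> {s..<t}|lborel. \<bar>f \<eta>\<bar>)"
        using set_integral_norm_bound[OF int_t] by simp
      also have "\<dots> \<le> (LINT \<eta>:T \<inter> {s..<b}|lborel. \<bar>f \<eta>\<bar>)"
        using set_integrable_norm[OF int] set_integrable_norm[OF int_t] t
        unfolding set_lebesgue_integral_def set_integrable_def
        by (intro integral_mono) (auto split: split_indicator)
      finally show ?thesis .
    qed
    then show ?thesis using 1 t by (simp add: delta_integral_def)
  qed
  then show ?thesis by blast
qed

text \<open>\<open>weight_bound\<close> is the smallness condition on \<open>lam\<close> multiplied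
  by \<open>decay \<eta>\<close> and rewritten with \<open>decay_fwd_jump\<close>. The
  \<open>max t0\<close> keeps \<open>delay_low\<close> within its domain; floors below
  \<open>t0\<close> contribute nothing in the application, where \<open>A\<close> vanishes
  there.\<close>

locale delay_equation = decay_weight T c A lam for T c A lam +
  fixes t0 :: real and \<alpha> :: "real \<Rightarrow> real"
  assumes lam_less_1: "lam < 1"
    and c_le: "c \<le> t0"
    and delay_T: "\<eta> \<in> T \<Longrightarrow> t0 \<le> \<eta> \<Longrightarrow> \<alpha> \<eta> \<in> T"
    and delay_le: "\<eta> \<in> T \<Longrightarrow> t0 \<le> \<eta> \<Longrightarrow> \<alpha> \<eta> \<le> \<eta>"
    and low_le: "t0 \<le> t \<Longrightarrow> t \<le> \<eta> \<Longrightarrow> \<eta> \<in> T \<Longrightarrow> delay_low T \<alpha> t \<le> \<alpha> \<eta>"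
    and low_mono: "t0 \<le> t \<Longrightarrow> t \<le> u \<Longrightarrow> delay_low T \<alpha> t \<le> delay_low T \<alpha> u"
    and low_T: "t0 \<le> t \<Longrightarrow> delay_low T \<alpha> t \<in> T"
    and low_ge: "t0 \<le> t \<Longrightarrow> c \<le> delay_low T \<alpha> t"
    and weight_bound: "\<eta> \<in> T \<Longrightarrow> t0 \<le> \<eta> \<Longrightarrow>
      integral {delay_low T \<alpha> \<eta>..fwd_jump T \<eta>}
        (\<lambda>u. rate u * decay (delay_low T \<alpha> (max t0 (ts_floor u))))
      \<le> (1 - lam) * decay (fwd_jump T \<eta>)"
begin

lemma low_decay_lb: "locally_bounded_borel (\<lambda>u. rate u * decay (delay_low T \<alpha> (max t0 (ts_floor u))))"
proof (intro locally_bounded_borel_mult rate_lb)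
  have "mono (\<lambda>u. - decay (delay_low T \<alpha> (max t0 (ts_floor u))))"
  proof (intro monoI)
    fix u v :: real assume "u \<le> v"
    then have "max t0 (ts_floor u) \<le> max t0 (ts_floor v)"
      using ts_floor_mono by (intro max.mono) (auto simp: mono_def)
    then show "- decay (delay_low T \<alpha> (max t0 (ts_floor u))) \<le> - decay (delay_low T \<alpha> (max t0 (ts_floor v)))"
      by (auto intro!: decay_antimono low_mono)
  qed
  from locally_bounded_borel_mult[OF locally_bounded_borel_const[of "-1"] locally_bounded_borel_mono[OF this]]
  show "locally_bounded_borel (\<lambda>u. decay (delay_low T \<alpha> (max t0 (ts_floor u))))" by simp
qed

lemma A_bounded:
  obtains B where "0 \<le> B" "\<And>\<eta>. \<eta> \<in> T \<Longrightarrow> c \<le> \<eta> \<Longrightarrow> \<eta> \<le> b \<Longrightarrow> A \<eta> \<le> B"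
proof -
  obtain B where B: "\<And>\<eta>. \<eta> \<in> T \<inter> {c..b} \<Longrightarrow> \<bar>A \<eta>\<bar> \<le> B"
    using adm_A unfolding admissible_def by meson
  have "A \<eta> \<le> max 0 B" if "\<eta> \<in> T" "c \<le> \<eta>" "\<eta> \<le> b" for \<eta>
    using B[of \<eta>] that by auto
  then show ?thesis using that[of "max 0 B"] by auto
qed

context
  fixes s x0 \<phi> x N
  assumes s: "s \<in> T" "t0 \<le> s"
    and init: "initial_function T \<alpha> s \<phi>" and sol: "is_solution T A \<alpha> s x0 \<phi> x"
  defines "N \<equiv> \<bar>x0\<bar> + history_norm T \<alpha> s \<phi>"
begin

lemma c_le_s: "c \<le> s" using c_le s by simp

lemma N_nonneg: "0 \<le> N"
  using history_norm_nonneg[OF init] by (simp add: N_def)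

lemma history_bound: "r \<in> T \<Longrightarrow> delay_low T \<alpha> s \<le> r \<Longrightarrow> r \<le> s \<Longrightarrow> \<bar>x r\<bar> \<le> N"
  using sol abs_le_history_norm[OF init, of r] history_norm_nonneg[OF init]
  by (cases "r = s") (auto simp: is_solution_def N_def history_dom_def)

lemma delay_arg:
  assumes "\<eta> \<in> T" "s \<le> \<eta>"
  shows "\<alpha> \<eta> \<in> T" "delay_low T \<alpha> s \<le> \<alpha> \<eta>" "\<alpha> \<eta> \<le> \<eta>"
  using assms s delay_T delay_le low_le by auto

text \<open>Finiteness of the suprema in the contraction arguments rests on this crude
  bound.\<close>

lemma solution_bounded:
  assumes "b \<in> T" "s \<le> b"
  obtains X where "0 \<le> X" "\<And>r. r \<in> T \<Longrightarrow> delay_low T \<alpha> s \<le> r \<Longrightarrow> r \<le> b \<Longrightarrow> \<bar>x r\<bar> \<le> X"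
proof -
  obtain B where B: "\<And>t. s \<le> t \<Longrightarrow> t \<le> b \<Longrightarrow> \<bar>delta_integral T s t (\<lambda>\<eta>. A \<eta> * x (\<alpha> \<eta>))\<bar> \<le> B"
    using delta_integral_bounded[OF T_borel, of s b "\<lambda>\<eta>. A \<eta> * x (\<alpha> \<eta>)"] sol assms
    by (auto simp: is_solution_def)
  have "\<bar>x r\<bar> \<le> N + \<bar>B\<bar> + \<bar>x0\<bar>" if r: "r \<in> T" "delay_low T \<alpha> s \<le> r" "r \<le> b" for r
  proof (cases "r \<le> s")
    case True
    then show ?thesis using history_bound r by fastforce
  next
    case False
    then have "x r = x0 - delta_integral T s r (\<lambda>\<eta>. A \<eta> * x (\<alpha> \<eta>))"
      using sol r by (auto simp: is_solution_def)
    then show ?thesis using B[of r] r False N_nonneg by auto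
  qed
  moreover have "0 \<le> N + \<bar>B\<bar> + \<bar>x0\<bar>" using N_nonneg by simp
  ultimately show ?thesis using that by blast
qed

text \<open>The solution is expressed through an ordinary integral. Measurability of the integrand
  is taken from the integrability clause in \<open>is_solution\<close>, and its boundedness from the
  bounds on \<open>A\<close> and \<open>x\<close>.\<close>

lemma solution_increment:
  assumes b: "b \<in> T" "s \<le> b"
  obtains h where "locally_bounded_borel h"
    "\<And>u. s \<le> u \<Longrightarrow> u < b \<Longrightarrow> h u = rate u * x (\<alpha> (ts_floor u))"
    "\<And>t t'. t \<in> T \<Longrightarrow> t' \<in> T \<Longrightarrow> s \<le> t \<Longrightarrow> t \<le> t' \<Longrightarrow> t' \<le> b \<Longrightarrow> x t - x t' = integral {t..t'} h"
proof -
  \<comment> \<open>Cutting off at \<open>b\<close> makes the integrand admissible. The point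
    \<open>b\<close> may be dropped because delta integrals up to \<open>t \<le> b\<close> exclude
    their right endpoint.\<close>
  define H where "H \<eta> = indicator (T \<inter> {s..<b}) \<eta> * (A \<eta> * x (\<alpha> \<eta>))" for \<eta>
  define h where "h u = H (ts_floor u)" for u
  obtain X where "0 \<le> X" and X: "\<And>r. r \<in> T \<Longrightarrow> delay_low T \<alpha> s \<le> r \<Longrightarrow> r \<le> b \<Longrightarrow> \<bar>x r\<bar> \<le> X"
    using solution_bounded[OF b] by blast
  obtain B where "0 \<le> B" and B: "\<And>\<eta>. \<eta> \<in> T \<Longrightarrow> c \<le> \<eta> \<Longrightarrow> \<eta> \<le> b \<Longrightarrow> A \<eta> \<le> B"
    using A_bounded by blast
  have adm: "admissible H"
    unfolding admissible_def
  proof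
    have "set_integrable lborel (T \<inter> {s..<b}) (\<lambda>\<eta>. A \<eta> * x (\<alpha> \<eta>))"
      using sol b by (auto simp: is_solution_def delta_integrable_def)
    then have "(\<lambda>\<eta>. indicator (T \<inter> {s..<b}) \<eta> *\<^sub>R (A \<eta> * x (\<alpha> \<eta>))) \<in> borel_measurable lborel"
      unfolding set_integrable_def by (rule borel_measurable_integrable)
    then have [measurable]: "H \<in> borel_measurable borel" by (simp add: H_def[abs_def])
    show "set_borel_measurable borel (T \<inter> {c..}) H"
      unfolding set_borel_measurable_def by measurable
    have "\<bar>H \<eta>\<bar> \<le> B * X" for \<eta>
    proof (cases "\<eta> \<in> T \<inter> {s..<b}")
      case True
      then have "\<bar>x (\<alpha> \<eta>)\<bar> \<le> X" using delay_arg[of \<eta>] X by auto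
      moreover have "\<bar>A \<eta>\<bar> \<le> B" using B[of \<eta>] A_nonneg[of \<eta>] True c_le_s by auto
      ultimately show ?thesis using True \<open>0 \<le> B\<close> by (simp add: H_def abs_mult mult_mono)
    qed (use \<open>0 \<le> B\<close> \<open>0 \<le> X\<close> in \<open>simp add: H_def\<close>)
    then show "\<forall>b. \<exists>B. \<forall>\<eta>\<in>T \<inter> {c..b}. \<bar>H \<eta>\<bar> \<le> B" by blast
  qed
  then have lb: "locally_bounded_borel h"
    unfolding h_def by (rule admissible_locally_bounded_borel)
  have x_eq: "x t = x0 - integral {s..t} h" if t: "t \<in> T" "s \<le> t" "t \<le> b" for t
  proof -
    have "delta_integral T s t (\<lambda>\<eta>. A \<eta> * x (\<alpha> \<eta>)) = delta_integral T s t H"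
      using t by (intro delta_integral_cong) (auto simp: H_def)
    then show ?thesis
      using sol t delta_integral_eq_integral[OF adm s(1) t(1) c_le_s t(2)]
      by (auto simp: is_solution_def h_def[abs_def])
  qed
  have diff: "x t - x t' = integral {t..t'} h"
    if "t \<in> T" "t' \<in> T" "s \<le> t" "t \<le> t'" "t' \<le> b" for t t'
    using x_eq[of t] x_eq[of t'] integral_diff[OF lb, of s t t'] that by auto
  have "h u = rate u * x (\<alpha> (ts_floor u))" if "s \<le> u" "u < b" for u
    using ts_floor_interval[OF s(1) c_le_s, of u b] that by (simp add: h_def H_def rate_def)
  from that[OF lb this diff] show ?thesis by blast
qed

text \<open>Gronwall's argument forwards in time for \<open>\<bar>x\<bar> / G\<close>: delayed
  arguments do not exceed the current time and \<open>G\<close> increases, so a bound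
  \<open>K G\<close> at the delayed time persists at the current one.\<close>

lemma solution_growth:
  assumes t: "t \<in> T" "delay_low T \<alpha> s \<le> t"
  shows "\<bar>x t\<bar> \<le> N * exp (integral {s..t} rate)"
proof (cases "t \<le> s")
  case True
  then show ?thesis using history_bound[OF t] by (cases "t = s") auto
next
  case False
  then have st: "s \<le> t" by simp
  define G where "G r = exp (integral {s..r} rate)" for r
  have G_pos: "0 < G r" for r by (simp add: G_def)
  have G_mono: "G u \<le> G v" if "u \<le> v" for u v
  proof (cases "s \<le> u")
    case True
    have "0 \<le> integral {u..v} rate"
      using rate_nonneg rate_lb locally_bounded_borel_integrable_on
      by (intro Henstock_Kurzweil_Integration.integral_nonneg) auto
    then show ?thesis using integral_diff[OF rate_lb True that] by (simp add: G_def)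
  next
    case False
    have "0 \<le> integral {s..v} rate"
      using rate_nonneg rate_lb locally_bounded_borel_integrable_on
      by (intro Henstock_Kurzweil_Integration.integral_nonneg) auto
    then show ?thesis using False by (simp add: G_def)
  qed
  \<comment> \<open>Before \<open>s\<close> the interval of integration is empty, so the bound
    \<open>N G\<close> includes the initial history.\<close>
  have G_s: "G r = 1" if "r \<le> s" for r
    using that by (cases "r = s") (auto simp: G_def)
  have G_lb: "locally_bounded_borel G"
    unfolding G_def by (intro locally_bounded_borel_continuous continuous_on_exp continuous_indefinite_integral rate_lb)
  obtain h where h: "locally_bounded_borel h"
    and h_eq: "\<And>u. s \<le> u \<Longrightarrow> u < t \<Longrightarrow> h u = rate u * x (\<alpha> (ts_floor u))"
    and x_diff: "\<And>r r'. r \<in> T \<Longrightarrow> r' \<in> T \<Longrightarrow> s \<le> r \<Longrightarrow> r \<le> r' \<Longrightarrow> r' \<le> t \<Longrightarrow> x r - x r' = integral {r..r'} h"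
    using solution_increment[OF t(1) st] by metis
  obtain X where "0 \<le> X" and X: "\<And>r. r \<in> T \<Longrightarrow> delay_low T \<alpha> s \<le> r \<Longrightarrow> r \<le> t \<Longrightarrow> \<bar>x r\<bar> \<le> X"
    using solution_bounded[OF t(1) st] by blast
  let ?D = "T \<inter> {delay_low T \<alpha> s..t}"
  have "\<bar>x t\<bar> / G t \<le> N"
  proof (rule le_if_contracting_upper_bound[where X = ?D and f = "\<lambda>r. \<bar>x r\<bar> / G r" and \<theta> = "inverse (G t)"])
    show "bdd_above ((\<lambda>r. \<bar>x r\<bar> / G r) ` ?D)"
    proof (rule bdd_aboveI2)
      fix r assume r: "r \<in> ?D"
      have "1 \<le> G r" using G_mono[of s r] G_mono[of r s] G_s[of s] G_s[of r] by (cases "s \<le> r") auto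
      then have "\<bar>x r\<bar> / G r \<le> \<bar>x r\<bar> / 1" by (intro divide_left_mono) auto
      then show "\<bar>x r\<bar> / G r \<le> X" using X[of r] r by auto
    qed
  next
    fix K r assume K: "N \<le> K" "\<And>z. z \<in> ?D \<Longrightarrow> \<bar>x z\<bar> / G z \<le> K" and r: "r \<in> ?D"
    have xK: "\<bar>x z\<bar> \<le> K * G z" if "z \<in> ?D" for z
      using K(2)[OF that] G_pos[of z] by (simp add: divide_le_eq)
    have K0: "0 \<le> K" using K N_nonneg by simp
    have inv: "(K - N) * inverse (G t) \<le> (K - N) * inverse (G r)"
      using r K G_mono[of r t] G_pos by (intro mult_left_mono) auto
    have "\<bar>x r\<bar> / G r \<le> K - (K - N) * inverse (G r)"
    proof (cases "r \<le> s")
      case True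
      then show ?thesis using history_bound r G_s by auto
    next
      case False
      have KG: "locally_bounded_borel (\<lambda>u. K * (rate u * G u))"
        by (intro locally_bounded_borel_mult locally_bounded_borel_const rate_lb G_lb)
      have h_le: "\<bar>h u\<bar> \<le> K * (rate u * G u)" if u: "s < u" "u < r" for u
      proof -
        have q: "ts_floor u \<in> T" "s \<le> ts_floor u" "ts_floor u < t" "ts_floor u \<le> u"
          using ts_floor_interval[OF s(1) c_le_s, of u t] ts_floor_le_self[of u] u r c_le_s by auto
        have "\<bar>x (\<alpha> (ts_floor u))\<bar> \<le> K * G (\<alpha> (ts_floor u))"
          using delay_arg[OF q(1,2)] q by (intro xK) auto
        also have "\<dots> \<le> K * G u"
          using K0 delay_arg[OF q(1,2)] q by (intro mult_left_mono G_mono) auto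
        finally have "rate u * \<bar>x (\<alpha> (ts_floor u))\<bar> \<le> rate u * (K * G u)"
          using rate_nonneg by (intro mult_left_mono) auto
        then show ?thesis using h_eq[of u] u r rate_nonneg[of u] by (simp add: abs_mult mult_ac)
      qed
      have "\<bar>integral {s..r} h\<bar> \<le> integral {s..r} (\<lambda>u. K * (rate u * G u))"
      proof -
        have "integral {s..r} h \<le> integral {s..r} (\<lambda>u. K * (rate u * G u))"
          using h_le by (intro integral_mono_open_interval h KG) fastforce
        moreover have "integral {s..r} (\<lambda>u. (-1) * h u) \<le> integral {s..r} (\<lambda>u. K * (rate u * G u))"
          using h_le by (intro integral_mono_open_interval locally_bounded_borel_mult locally_bounded_borel_const h KG) fastforce
        ultimately show ?thesis by simp
      qed
      \<comment> \<open>The exponential chain rule evaluates the integral of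
        \<open>rate u * G u\<close>.\<close>
      also have "\<dots> = K * (G r - 1)"
        using exp_integral_diff[OF rate_lb, of s s r] False by (simp add: G_def)
      finally have "\<bar>x r - x s\<bar> \<le> K * (G r - 1)"
        using x_diff[of s r] s r False by auto
      moreover have "\<bar>x s\<bar> \<le> N" using history_bound[of s] low_le[of s s] delay_le[of s] s by auto
      ultimately have "\<bar>x r\<bar> \<le> N + K * (G r - 1)" by linarith
      then have "\<bar>x r\<bar> / G r \<le> (N + K * (G r - 1)) / G r"
        using G_pos by (intro divide_right_mono) (auto simp: less_imp_le)
      also have "\<dots> = K - (K - N) * inverse (G r)"
        using G_pos[of r] by (simp add: field_simps)
      finally show ?thesis .
    qed
    then show "\<bar>x r\<bar> / G r \<le> K - (K - N) * inverse (G t)" using inv by linarith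
  qed (use t st G_pos in auto)
  then show ?thesis using G_pos[of t] by (simp add: G_def divide_le_eq)
qed

end

end

section \<open>Comparison of solutions with the decaying weight\<close>

context delay_equation
begin

text \<open>The signs \<open>\<epsilon> = 1\<close> and \<open>\<epsilon> = -1\<close> treat both
  sides of \<open>\<bar>x\<bar> \<le> K E\<close> at once. Read backwards, Gronwall's inequality
  bounds \<open>w r\<close> from below by a fraction of \<open>w s2\<close>. The condition
  \<open>low\<close> keeps the delay windows after \<open>s2\<close> inside the region where the
  equation holds.\<close>

lemma solution_decay_step:
  fixes \<epsilon> :: real
  assumes s: "s \<in> T" "t0 \<le> s" and init: "initial_function T \<alpha> s \<phi>" and sol: "is_solution T A \<alpha> s x0 \<phi> x"
    and s2: "s2 \<in> T" "s \<le> s2" and low: "\<And>v. s2 < v \<Longrightarrow> s \<le> delay_low T \<alpha> (ts_floor v)"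
    and r: "r \<in> T" "s2 \<le> r" and eps: "\<bar>\<epsilon>\<bar> = 1" and "0 \<le> K"
    and xK: "\<And>z. z \<in> T \<Longrightarrow> delay_low T \<alpha> s \<le> z \<Longrightarrow> z \<le> r \<Longrightarrow> \<bar>x z\<bar> \<le> K * decay z"
    and B: "0 \<le> B" "\<And>\<eta>. \<eta> \<in> T \<Longrightarrow> c \<le> \<eta> \<Longrightarrow> \<eta> \<le> r \<Longrightarrow> A \<eta> \<le> B"
  shows "K * decay s2 - \<epsilon> * x s2 \<le> (K * decay r - \<epsilon> * x r) * exp (B * (r - s2))"
proof -
  let ?w = "\<lambda>t. K * decay t - \<epsilon> * x t"
  let ?k = "\<lambda>u. rate u * decay (delay_low T \<alpha> (max t0 (ts_floor u)))"
  let ?g = "\<lambda>u. rate u * decay (fwd_jump T (ts_floor u))"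
  have cs: "c \<le> s" using c_le s by simp
  have low_s: "delay_low T \<alpha> s \<le> s" using low_le[of s s] delay_le[of s] s by auto
  have x_le: "\<bar>\<epsilon> * x z\<bar> \<le> K * decay z" if "z \<in> T" "delay_low T \<alpha> s \<le> z" "z \<le> r" for z
    using xK[OF that] eps by (simp add: abs_mult)
  obtain h where h: "locally_bounded_borel h"
    and h_eq: "\<And>u. s \<le> u \<Longrightarrow> u < r \<Longrightarrow> h u = rate u * x (\<alpha> (ts_floor u))"
    and x_diff: "\<And>t t'. t \<in> T \<Longrightarrow> t' \<in> T \<Longrightarrow> s \<le> t \<Longrightarrow> t \<le> t' \<Longrightarrow> t' \<le> r \<Longrightarrow> x t - x t' = integral {t..t'} h"
    using solution_increment[OF s init sol r(1)] s2 r by (metis order_trans)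
  have h_le: "\<bar>h u\<bar> \<le> K * ?k u" if u: "s \<le> u" "u < r" for u
  proof -
    have q: "ts_floor u \<in> T" "s \<le> ts_floor u" "ts_floor u < r"
      using ts_floor_interval[OF s(1) cs, of u r] u by auto
    note a = delay_arg[OF s init sol q(1,2)]
    have "\<bar>x (\<alpha> (ts_floor u))\<bar> \<le> K * decay (\<alpha> (ts_floor u))"
      using a q by (intro xK) auto
    also have "\<dots> \<le> K * decay (delay_low T \<alpha> (max t0 (ts_floor u)))"
      using low_le[of "ts_floor u" "ts_floor u"] q s \<open>0 \<le> K\<close>
      by (intro mult_left_mono decay_antimono) (auto simp: max_def)
    finally have "rate u * \<bar>x (\<alpha> (ts_floor u))\<bar> \<le> rate u * (K * decay (delay_low T \<alpha> (max t0 (ts_floor u))))"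
      using rate_nonneg by (intro mult_left_mono) auto
    then show ?thesis using h_eq[OF u] rate_nonneg[of u] by (simp add: abs_mult mult_ac)
  qed
  have Kk: "locally_bounded_borel (\<lambda>u. K * ?k u)"
    by (intro locally_bounded_borel_mult[OF locally_bounded_borel_const] low_decay_lb)
  have Kg: "locally_bounded_borel (\<lambda>u. (K * lam) * ?g u)"
    by (intro locally_bounded_borel_mult[OF locally_bounded_borel_const] rate_decay_lb)
  have eh: "locally_bounded_borel (\<lambda>u. (- \<epsilon>) * h u)"
    by (intro locally_bounded_borel_mult[OF locally_bounded_borel_const] h)
  \<comment> \<open>This is \<open>- w\<^sup>\<Delta>\<close> composed with the floor, integrated in
    place of a derivative of \<open>w\<close>.\<close>
  define e where "e u = (K * lam) * ?g u + (- \<epsilon>) * h u" for u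
  have e_lb: "locally_bounded_borel e"
    unfolding e_def by (intro locally_bounded_borel_add Kg eh)
  show ?thesis
  proof (rule backward_gronwall[where w = ?w, OF s2(1) r(1) _ r(2) B(1) e_lb])
    show "c \<le> s2" using cs s2 by simp
    show "0 \<le> ?w r" using x_le[of r] r s2 low_s by auto
  next
    fix t assume t: "t \<in> T" "s2 \<le> t" "t \<le> r"
    have "integral {t..r} e = (K * lam) * integral {t..r} ?g + (- \<epsilon>) * integral {t..r} h"
      unfolding e_def
      using Henstock_Kurzweil_Integration.integral_add[OF locally_bounded_borel_integrable_on[OF Kg]
          locally_bounded_borel_integrable_on[OF eh], of t r] by simp
    moreover have "decay t - decay r = lam * integral {t..r} ?g"
      using t r s2 cs by (intro decay_diff) auto
    moreover have "x t - x r = integral {t..r} h"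
      using t r s2 by (intro x_diff) auto
    ultimately show "?w t - ?w r = integral {t..r} e"
      by (simp add: algebra_simps flip: right_diff_distrib')
  next
    fix v assume v: "s2 < v" "v < r"
    define \<eta> where "\<eta> = ts_floor v"
    let ?j = "fwd_jump T \<eta>"
    have \<eta>: "\<eta> \<in> T" "s2 \<le> \<eta>" "\<eta> < r"
      using ts_floor_interval[OF s2(1), of v r] v cs s2 by (auto simp: \<eta>_def)
    have j: "?j \<in> T" "\<eta> \<le> ?j" "?j \<le> r"
      using fwd_jump_in_T fwd_jump_ge fwd_jump_le[OF r(1) \<eta>(3)] by auto
    have t0\<eta>: "t0 \<le> \<eta>" using s s2 \<eta> by simp
    have low_\<eta>: "s \<le> delay_low T \<alpha> \<eta>" using low[OF v(1)] by (simp add: \<eta>_def)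
    have a: "\<alpha> \<eta> \<in> T" "delay_low T \<alpha> \<eta> \<le> \<alpha> \<eta>" "\<alpha> \<eta> \<le> \<eta>"
      using delay_T delay_le low_le[of \<eta> \<eta>] \<eta> t0\<eta> by auto
    have A0: "0 \<le> A \<eta>" using A_nonneg \<eta> t0\<eta> c_le by auto
    \<comment> \<open>The equation is integrated from \<alpha> \<eta> to the jump; the nonnegative
      bound for \<open>h\<close> permits enlarging the interval to the window of
      \<open>weight_bound\<close>.\<close>
    have "\<bar>x (\<alpha> \<eta>) - x ?j\<bar> \<le> K * ((1 - lam) * decay ?j)"
    proof -
      have "x (\<alpha> \<eta>) - x ?j = integral {\<alpha> \<eta>..?j} h"
        using a j low_\<eta> by (intro x_diff) auto
      moreover have "integral {\<alpha> \<eta>..?j} h \<le> integral {\<alpha> \<eta>..?j} (\<lambda>u. K * ?k u)"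
        using a j low_\<eta> by (intro integral_mono_open_interval h Kk order_trans[OF abs_ge_self h_le]) auto
      moreover have "integral {\<alpha> \<eta>..?j} (\<lambda>u. (-1) * h u) \<le> integral {\<alpha> \<eta>..?j} (\<lambda>u. K * ?k u)"
        using a j low_\<eta>
        by (intro integral_mono_open_interval locally_bounded_borel_mult[OF locally_bounded_borel_const] h Kk)
          (auto intro!: order_trans[OF _ h_le])
      ultimately have "\<bar>x (\<alpha> \<eta>) - x ?j\<bar> \<le> integral {\<alpha> \<eta>..?j} (\<lambda>u. K * ?k u)" by simp
      also have "\<dots> = K * integral {\<alpha> \<eta>..?j} ?k" by simp
      also have "\<dots> \<le> K * integral {delay_low T \<alpha> \<eta>..?j} ?k"
        using a locally_bounded_borel_integrable_on[OF low_decay_lb] rate_nonneg less_imp_le[OF decay_pos] \<open>0 \<le> K\<close>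
        by (intro mult_left_mono integral_subset_le) auto
      also have "\<dots> \<le> K * ((1 - lam) * decay ?j)"
        using weight_bound[OF \<eta>(1) t0\<eta>] \<open>0 \<le> K\<close> by (intro mult_left_mono) auto
      finally show ?thesis .
    qed
    then have "\<bar>\<epsilon> * (x (\<alpha> \<eta>) - x ?j)\<bar> \<le> K * ((1 - lam) * decay ?j)"
      using eps by (simp add: abs_mult)
    \<comment> \<open>The error \<open>(1 - lam) K E\<^sup>\<sigma>\<close> of replacing
      \<open>x (\<alpha> \<eta>)\<close> by its value at the jump exactly completes
      \<open>lam K E\<^sup>\<sigma>\<close> to \<open>K E\<^sup>\<sigma>\<close>.\<close>
    then have "K * lam * decay ?j - \<epsilon> * x (\<alpha> \<eta>) \<le> ?w ?j"
      by (simp add: algebra_simps abs_le_iff)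
    then have "A \<eta> * (K * lam * decay ?j - \<epsilon> * x (\<alpha> \<eta>)) \<le> A \<eta> * ?w ?j"
      using A0 by (intro mult_left_mono) auto
    \<comment> \<open>Replacing \<open>A\<close> by its bound uses \<open>0 \<le> w\<close> at the
      jump, which follows from \<open>xK\<close>.\<close>
    moreover have "A \<eta> * ?w ?j \<le> B * ?w ?j"
      using B(2)[of \<eta>] \<eta> t0\<eta> c_le x_le[of ?j] j s2 low_s by (intro mult_right_mono) auto
    moreover have "e v = A \<eta> * (K * lam * decay ?j - \<epsilon> * x (\<alpha> \<eta>))"
      using h_eq[of v] v s2 by (simp add: e_def rate_def \<eta>_def algebra_simps)
    ultimately show "e v \<le> B * ?w (fwd_jump T (ts_floor v))" by (simp add: \<eta>_def)
  qed
qed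

lemma solution_decay:
  assumes s: "s \<in> T" "t0 \<le> s" and init: "initial_function T \<alpha> s \<phi>" and sol: "is_solution T A \<alpha> s x0 \<phi> x"
    and s2: "s2 \<in> T" "s \<le> s2" and low: "\<And>v. s2 < v \<Longrightarrow> s \<le> delay_low T \<alpha> (ts_floor v)"
    and D: "integral {s..s2} rate \<le> D"
    and t: "t \<in> T" "s \<le> t"
  shows "\<bar>x t\<bar> \<le> exp (2 * D) * (\<bar>x0\<bar> + history_norm T \<alpha> s \<phi>) * (decay t / decay s)"
proof -
  define N where "N = \<bar>x0\<bar> + history_norm T \<alpha> s \<phi>"
  \<comment> \<open>Up to \<open>s2\<close>, one factor \<open>exp D\<close> pays for the growth of
    \<open>x\<close> and the other for the loss in the weight.\<close>
  define C where "C = exp (2 * D) * N / decay s"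
  \<comment> \<open>The set of times must reach \<open>s2\<close> even when \<open>t\<close> comes
    earlier.\<close>
  define b where "b = max t s2"
  have b: "b \<in> T" "s2 \<le> b" "t \<le> b" using t s2 by (auto simp: b_def max_def)
  have cs: "c \<le> s" using c_le s by simp
  have low_s: "delay_low T \<alpha> s \<le> s" using low_le[of s s] delay_le[of s] s by auto
  have N0: "0 \<le> N" using N_nonneg[OF s init sol] by (simp add: N_def)
  then have C0: "0 \<le> C" using decay_pos[of s] by (simp add: C_def)
  have D0: "0 \<le> D"
  proof -
    have "0 \<le> integral {s..s2} rate"
      using rate_nonneg locally_bounded_borel_integrable_on[OF rate_lb]
      by (intro Henstock_Kurzweil_Integration.integral_nonneg) auto
    then show ?thesis using D by simp
  qed
  have initial: "\<bar>x r\<bar> \<le> C * decay r" if r: "r \<in> T" "delay_low T \<alpha> s \<le> r" "r \<le> s2" for r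
  proof -
    have "integral {s..r} rate \<le> D"
    proof -
      have "integral {s..r} rate \<le> integral {s..s2} rate"
        using r rate_nonneg locally_bounded_borel_integrable_on[OF rate_lb] by (intro integral_subset_le) auto
      then show ?thesis using D by simp
    qed
    then have "\<bar>x r\<bar> \<le> N * exp D"
      using order_trans[OF solution_growth[OF s init sol r(1,2)] mult_left_mono[of "exp (integral {s..r} rate)" "exp D"]]
        N0 by (simp add: N_def)
    moreover have "decay s * exp (- D) \<le> decay r"
    proof (cases "r \<le> s")
      case True
      have "decay s * exp (- D) \<le> decay s * 1" using D0 decay_pos[of s] by (intro mult_left_mono) auto
      then show ?thesis using decay_antimono[OF True] by simp
    next
      case False
      \<comment> \<open>Here \<open>lam < 1\<close> enters through
        \<open>log_rate \<le> lam * rate \<le> rate\<close>.\<close>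
      have "integral {s..r} log_rate \<le> integral {s..r} rate"
        using log_rate_le rate_nonneg lam_less_1
        by (intro integral_le locally_bounded_borel_integrable_on log_rate_lb rate_lb)
          (metis mult_right_mono mult_1 order_trans less_imp_le)
      then have "exp (- D) \<le> exp (- integral {s..r} log_rate)"
        using \<open>integral {s..r} rate \<le> D\<close> by simp
      then show ?thesis
        using decay_ratio[of s r] False cs decay_pos[of s] by (simp add: field_simps)
    qed
    then have "C * (decay s * exp (- D)) \<le> C * decay r" using C0 by (intro mult_left_mono)
    moreover have "C * (decay s * exp (- D)) = N * exp D"
    proof -
      have "exp (2 * D) * exp (- D) = exp D" by (simp flip: exp_add)
      then show ?thesis using decay_pos[of s] by (simp add: C_def mult_ac)
    qed
    ultimately show ?thesis by simp
  qed
  obtain B where B: "0 \<le> B" "\<And>\<eta>. \<eta> \<in> T \<Longrightarrow> c \<le> \<eta> \<Longrightarrow> \<eta> \<le> b \<Longrightarrow> A \<eta> \<le> B"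
    using A_bounded by blast
  obtain X where "0 \<le> X" and X: "\<And>r. r \<in> T \<Longrightarrow> delay_low T \<alpha> s \<le> r \<Longrightarrow> r \<le> b \<Longrightarrow> \<bar>x r\<bar> \<le> X"
    using solution_bounded[OF s init sol b(1)] s2 b by (metis order_trans)
  let ?D = "T \<inter> {delay_low T \<alpha> s..b}"
  \<comment> \<open>This is the fraction of \<open>K - C\<close> that survives the backward Gronwall
    estimate, uniformly for \<open>r \<le> b\<close>. Being at most 1, it also suits the times up to
    \<open>s2\<close>, where \<open>C\<close> already works.\<close>
  define \<theta> where "\<theta> = decay s2 * exp (- (B * (b - s2)))"
  have \<theta>: "0 < \<theta>" "\<theta> \<le> 1"
    using decay_pos[of s2] decay_le_1[of s2] B(1) b by (auto simp: \<theta>_def intro!: mult_le_one)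
  have "\<bar>x t\<bar> / decay t \<le> C"
  proof (rule le_if_contracting_upper_bound[where X = ?D and f = "\<lambda>r. \<bar>x r\<bar> / decay r" and \<theta> = \<theta>])
    show "bdd_above ((\<lambda>r. \<bar>x r\<bar> / decay r) ` ?D)"
    proof (rule bdd_aboveI2)
      fix r assume r: "r \<in> ?D"
      have "\<bar>x r\<bar> / decay r \<le> X / decay b"
        using X[of r] r decay_pos[of b] decay_antimono[of r b] by (intro frac_le) auto
      then show "\<bar>x r\<bar> / decay r \<le> X / decay b" .
    qed
  next
    fix K r assume K: "C \<le> K" "\<And>z. z \<in> ?D \<Longrightarrow> \<bar>x z\<bar> / decay z \<le> K" and r: "r \<in> ?D"
    have K0: "0 \<le> K" using C0 K by simp
    have xK: "\<bar>x z\<bar> \<le> K * decay z" if "z \<in> ?D" for z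
      using K(2)[OF that] decay_pos[of z] by (simp add: divide_le_eq)
    show "\<bar>x r\<bar> / decay r \<le> K - (K - C) * \<theta>"
    proof (cases "r \<le> s2")
      case True
      then have "\<bar>x r\<bar> / decay r \<le> C"
        using initial[of r] r decay_pos[of r] by (auto simp: divide_le_eq)
      also have "(K - C) * \<theta> \<le> (K - C) * 1" using K \<theta> by (intro mult_left_mono) auto
      then have "C \<le> K - (K - C) * \<theta>" by simp
      finally show ?thesis .
    next
      case False
      have step: "\<epsilon> * x r \<le> (K - (K - C) * \<theta>) * decay r" if eps: "\<bar>\<epsilon>\<bar> = 1" for \<epsilon>
      proof -
        have w: "K * decay s2 - \<epsilon> * x s2 \<le> (K * decay r - \<epsilon> * x r) * exp (B * (r - s2))"
          using r False xK B K0
          by (intro solution_decay_step[OF s init sol s2 low _ _ eps]) auto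
        have "\<epsilon> * x s2 \<le> \<bar>x s2\<bar>" using eps by (metis abs_ge_self abs_mult mult_1)
        also have "\<dots> \<le> C * decay s2" using initial[of s2] s2 low_s by auto
        \<comment> \<open>The initial estimate at \<open>s2\<close> leaves a positive margin
          whenever \<open>K > C\<close>.\<close>
        finally have "(K - C) * decay s2 \<le> K * decay s2 - \<epsilon> * x s2" by (simp add: algebra_simps)
        with w have "(K - C) * decay s2 \<le> (K * decay r - \<epsilon> * x r) * exp (B * (r - s2))" by simp
        from mult_right_mono[OF this, of "exp (- (B * (r - s2)))"]
        have "(K - C) * decay s2 * exp (- (B * (r - s2))) \<le> K * decay r - \<epsilon> * x r"
          by (simp add: mult.assoc flip: exp_add)
        moreover have "(K - C) * \<theta> * decay r \<le> (K - C) * decay s2 * exp (- (B * (r - s2)))"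
        proof -
          have "\<theta> * decay r \<le> \<theta> * 1" using \<theta> decay_le_1 by (intro mult_left_mono) auto
          also have "\<theta> * 1 \<le> decay s2 * exp (- (B * (r - s2)))"
            unfolding \<theta>_def using r B(1) less_imp_le[OF decay_pos[of s2]]
            by (auto intro!: mult_left_mono)
          finally have "(K - C) * (\<theta> * decay r) \<le> (K - C) * (decay s2 * exp (- (B * (r - s2))))"
            using K by (intro mult_left_mono) auto
          then show ?thesis by (simp add: mult.assoc)
        qed
        ultimately show ?thesis by (simp add: algebra_simps)
      qed
      have "\<bar>x r\<bar> \<le> (K - (K - C) * \<theta>) * decay r"
        using step[of 1] step[of "-1"] by simp
      then show ?thesis using decay_pos[of r] by (simp add: divide_le_eq)
    qed
  qed (use t b low_s \<theta> in auto)
  then have "\<bar>x t\<bar> \<le> C * decay t" using decay_pos[of t] by (simp add: divide_le_eq)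
  then show ?thesis by (simp add: C_def N_def)
qed

end

section \<open>Verification of the hypotheses and the final estimate\<close>

theorem theorem3p6:
  fixes T :: "real set" and t0 lam0 :: real and A \<alpha> :: "real \<Rightarrow> real"
  assumes "time_scale T" and "\<not> bdd_above T" and "t0 \<in> T"
    and "\<forall>t\<in>T \<inter> {t0..}. A t \<ge> 0"
    and "\<forall>t\<in>T. t < t0 \<longrightarrow> A t = 0"
    and "rd_continuous_on T (T \<inter> {t0..}) A"
    and "\<forall>t\<in>T \<inter> {t0..}. \<alpha> t \<in> T"
    and "rd_continuous_on T (T \<inter> {t0..}) \<alpha>"
    and "filterlim \<alpha> at_top (inf at_top (principal (T \<inter> {t0..})))"
    and "\<forall>t\<in>T \<inter> {t0..}. \<alpha> t \<le> t"
    and "(SUP s\<in>T \<inter> {t0..}. ereal (delta_integral T s (delay_inv T t0 \<alpha> s) A)) < \<infinity>"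
    and "(SUP s\<in>T \<inter> {t0..}. ereal (delay_inv T t0 \<alpha> s - s)) < \<infinity>"
    and "(SUP t\<in>T \<inter> {t0..}. ereal (delta_integral T (delay_low T \<alpha> t) (fwd_jump T t) A)) < 1"
    and "0 < lam0" and "lam0 < 1"
    and "\<forall>t\<in>T \<inter> {t0..}.
           delta_integral T (delay_low T \<alpha> t) (fwd_jump T t)
             (\<lambda>\<eta>. ts_exp T (\<lambda>r. lam0 * A r) t (delay_low T \<alpha> \<eta>) * A \<eta>)
           < (1 - lam0) / (1 + lam0 * A t * graininess T t)"
    and "\<exists>M1>0. \<exists>lam1>0. \<forall>t\<in>T. \<forall>s\<in>T. t0 \<le> s \<and> s \<le> t \<longrightarrow>
           ts_exp T (ominus T (\<lambda>r. lam0 * A r)) t s \<le> M1 * ts_exp T (ominus T (\<lambda>_. lam1)) t s"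
  shows "uniformly_exponentially_stable T t0 A \<alpha>"
proof -
  \<comment> \<open>All delayed times lie at or above this point; between it and \<open>t0\<close>
    the coefficient is extended by zero.\<close>
  define c where "c = delay_low T \<alpha> t0"
  interpret D: delay_function T t0 \<alpha>
    using assms by unfold_locales (auto simp: time_scale_def)
  have c: "c \<in> T" "c \<le> t0"
    using assms(3) D.delay_low_in_T[of t0] D.delay_low_le_self[of t0] by (auto simp: c_def)
  interpret W: unbounded_time_scale T c
    using assms c by unfold_locales (auto simp: time_scale_def)
  have A_nonneg: "0 \<le> A \<eta>" if "\<eta> \<in> T" for \<eta>
    using assms(4,5) that by (cases "t0 \<le> \<eta>") auto
  have adm: "W.admissible A"
    unfolding W.admissible_def
  proof
    have "(\<lambda>\<eta>. indicator (T \<inter> {t0..}) \<eta> *\<^sub>R A \<eta>) \<in> borel_measurable borel"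
      using W.rd_continuous_on_measurable[OF assms(6)] by (simp add: set_borel_measurable_def)
    then show "set_borel_measurable borel (T \<inter> {c..}) A"
      unfolding set_borel_measurable_def
      by (rule measurable_cong[THEN iffD1, rotated])
        (use assms(5) c in \<open>auto split: split_indicator\<close>)
    show "\<forall>b. \<exists>B. \<forall>\<eta>\<in>T \<inter> {c..b}. \<bar>A \<eta>\<bar> \<le> B"
    proof
      fix b
      obtain B where B: "\<And>\<eta>. \<eta> \<in> T \<inter> {t0..b} \<Longrightarrow> \<bar>A \<eta>\<bar> \<le> B"
        using W.rd_continuous_on_bounded[OF assms(6)] by metis
      have "\<bar>A \<eta>\<bar> \<le> \<bar>B\<bar>" if "\<eta> \<in> T \<inter> {c..b}" for \<eta>
        using B[of \<eta>] assms(5) that by (cases "t0 \<le> \<eta>") auto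
      then show "\<exists>B. \<forall>\<eta>\<in>T \<inter> {c..b}. \<bar>A \<eta>\<bar> \<le> B" by blast
    qed
  qed
  interpret W: decay_weight T c A lam0
    using adm A_nonneg assms(14) by unfold_locales auto
  have low_ge: "c \<le> delay_low T \<alpha> t" if "t0 \<le> t" for t
    using D.delay_low_mono[of t0 t] that by (simp add: c_def)
  have weight_bound: "integral {delay_low T \<alpha> t..fwd_jump T t}
        (\<lambda>u. W.rate u * W.decay (delay_low T \<alpha> (max t0 (W.ts_floor u))))
      \<le> (1 - lam0) * W.decay (fwd_jump T t)" if t: "t \<in> T" "t0 \<le> t" for t
  proof -
    let ?G = "\<lambda>\<eta>. W.decay (delay_low T \<alpha> (max t0 \<eta>))"
    let ?j = "fwd_jump T t"
    have low_t: "delay_low T \<alpha> t \<in> T" "delay_low T \<alpha> t \<le> t" "c \<le> delay_low T \<alpha> t"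
      using D.delay_low_in_T[of t] D.delay_low_le_self[of t] low_ge[of t] t by auto
    have t_j: "t \<le> ?j" by (rule W.fwd_jump_ge)
    have "mono (\<lambda>\<eta>. - ?G \<eta>)"
      by (auto intro!: monoI W.decay_antimono D.delay_low_mono)
    from locally_bounded_borel_mult[OF locally_bounded_borel_mono[OF this] locally_bounded_borel_const[of "- (1 / W.decay t)"]]
    have G_lb: "locally_bounded_borel (\<lambda>\<eta>. ?G \<eta> * (1 / W.decay t))" by simp
    have "delta_integral T (delay_low T \<alpha> t) ?j (\<lambda>\<eta>. ts_exp T (\<lambda>r. lam0 * A r) t (delay_low T \<alpha> \<eta>) * A \<eta>)
      = delta_integral T (delay_low T \<alpha> t) ?j (\<lambda>\<eta>. A \<eta> * (?G \<eta> * (1 / W.decay t)))"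
    proof (rule delta_integral_cong)
      fix \<eta> assume \<eta>: "\<eta> \<in> T" "\<eta> < ?j"
      show "ts_exp T (\<lambda>r. lam0 * A r) t (delay_low T \<alpha> \<eta>) * A \<eta> = A \<eta> * (?G \<eta> * (1 / W.decay t))"
      proof (cases "t0 \<le> \<eta>")
        case True
        have "\<eta> \<le> t" using W.fwd_jump_le[of \<eta> t] \<eta> by force
        \<comment> \<open>A point of \<open>T\<close> before the forward jump of \<open>t\<close> is
          at most \<open>t\<close>, so the exponential runs forwards in time and equals a quotient
          of weights.\<close>
        then have "ts_exp T (\<lambda>r. lam0 * A r) t (delay_low T \<alpha> \<eta>) = W.decay (delay_low T \<alpha> \<eta>) / W.decay t"
          using True t \<eta> D.delay_low_in_T[of \<eta>] D.delay_low_le_self[of \<eta>] low_ge[of \<eta>]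
          by (intro W.ts_exp_rate) auto
        then show ?thesis using True by (simp add: max_def)
      qed (use assms(5) \<eta> in simp)
    qed (use low_t t_j in simp)
    also have "\<dots> = integral {delay_low T \<alpha> t..?j} (\<lambda>u. A (W.ts_floor u) * (?G (W.ts_floor u) * (1 / W.decay t)))"
      using low_t t_j W.fwd_jump_in_T
      by (intro W.delta_integral_eq_integral W.admissible_mult adm G_lb) auto
    also have "\<dots> = integral {delay_low T \<alpha> t..?j} (\<lambda>u. W.rate u * ?G (W.ts_floor u)) / W.decay t"
      by (simp add: W.rate_def)
    finally have eq: "delta_integral T (delay_low T \<alpha> t) ?j
        (\<lambda>\<eta>. ts_exp T (\<lambda>r. lam0 * A r) t (delay_low T \<alpha> \<eta>) * A \<eta>)
      = integral {delay_low T \<alpha> t..?j} (\<lambda>u. W.rate u * ?G (W.ts_floor u)) / W.decay t" .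
    let ?p = "1 + lam0 * A t * graininess T t"
    have "integral {delay_low T \<alpha> t..?j} (\<lambda>u. W.rate u * ?G (W.ts_floor u)) / W.decay t
        < (1 - lam0) / (1 + lam0 * A t * graininess T t)"
      unfolding eq[symmetric] using assms(16) t by blast
    then have "integral {delay_low T \<alpha> t..?j} (\<lambda>u. W.rate u * ?G (W.ts_floor u))
        < (1 - lam0) / ?p * W.decay t"
      using W.decay_pos[of t] by (simp add: pos_divide_less_eq)
    \<comment> \<open>The jump factor of the weight cancels the denominator of the smallness
      condition.\<close>
    also have "W.decay t = W.decay ?j * ?p"
      using W.decay_fwd_jump t c by auto
    also have "0 < ?p"
      using A_nonneg[OF t(1)] assms(14) W.graininess_nonneg[of t] by (simp add: add_pos_nonneg)
    then have "(1 - lam0) / ?p * (W.decay ?j * ?p) = (1 - lam0) * W.decay ?j" by simp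
    finally show ?thesis by (rule less_imp_le)
  qed
  interpret W: delay_equation T c A lam0 t0 \<alpha>
    using assms(15) c low_ge weight_bound D.delay_in_T D.delay_le D.delay_low_le D.delay_low_mono D.delay_low_in_T
    by unfold_locales auto
  obtain B where B: "\<And>s. s \<in> T \<Longrightarrow> t0 \<le> s \<Longrightarrow> delta_integral T s (delay_inv T t0 \<alpha> s) A \<le> B"
  proof -
    obtain n :: nat where n: "(SUP s\<in>T \<inter> {t0..}. ereal (delta_integral T s (delay_inv T t0 \<alpha> s) A)) < ereal n"
      using assms(11) less_PInf_Ex_of_nat by auto
    have "delta_integral T s (delay_inv T t0 \<alpha> s) A \<le> n" if "s \<in> T" "t0 \<le> s" for s
      using SUP_lessD[OF n, of s] that by auto
    then show ?thesis using that by blast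
  qed
  obtain M1 lam1 where M1: "0 < M1" "0 < lam1"
    and exp_bound: "\<And>t s. t \<in> T \<Longrightarrow> s \<in> T \<Longrightarrow> t0 \<le> s \<Longrightarrow> s \<le> t \<Longrightarrow>
      ts_exp T (ominus T (\<lambda>r. lam0 * A r)) t s \<le> M1 * ts_exp T (ominus T (\<lambda>_. lam1)) t s"
    using assms(17) by blast
  have main: "\<bar>x t\<bar> \<le> exp (2 * (B + 1)) * M1 * ts_exp T (ominus T (\<lambda>_. lam1)) t s
      * (\<bar>x0\<bar> + history_norm T \<alpha> s \<phi>)"
    if s: "s \<in> T" "t0 \<le> s" and init: "initial_function T \<alpha> s \<phi>" and sol: "is_solution T A \<alpha> s x0 \<phi> x"
      and t: "t \<in> T" "s \<le> t" for s x0 \<phi> x t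
  proof -
    define s1 where "s1 = delay_inv T t0 \<alpha> s"
    \<comment> \<open>At \<open>s1\<close> itself the window may still reach back before
      \<open>s\<close>. Beyond the forward jump every floor is strictly greater than
      \<open>s1\<close>.\<close>
    define s2 where "s2 = fwd_jump T s1"
    have s1: "s1 \<in> T" "s \<le> s1" using D.delay_inv_in_T D.delay_inv_ge s by (auto simp: s1_def)
    have s2: "s2 \<in> T" "s1 \<le> s2" using W.fwd_jump_in_T W.fwd_jump_ge by (auto simp: s2_def)
    have low: "s \<le> delay_low T \<alpha> (W.ts_floor v)" if v: "s2 < v" for v
    proof -
      have "s1 < W.ts_floor v"
        using W.ts_floor_greatest[of s2 v] W.ts_floor_greatest[of s1 v] W.le_fwd_jump_ts_floor[of v] v s2 s1 s c
        by (cases "W.ts_floor v = s1") (auto simp: s2_def)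
      then show ?thesis
        using D.delay_low_gt_if_gt_delay_inv[of "W.ts_floor v" s] W.ts_floor_in_T[of v] s1 s
        by (auto simp: s1_def)
    qed
    have 1: "integral {s..s1} W.rate \<le> B"
      using B[OF s] W.delta_integral_eq_integral[OF adm s(1) s1(1)] s s1 c by (simp add: s1_def W.rate_def[abs_def])
    \<comment> \<open>The window at \<open>s1\<close> contains the step from \<open>s1\<close> to
      \<open>s2\<close>, so passing to the jump raises the bound \<open>B\<close> by at most
      1.\<close>
    have "delta_integral T (delay_low T \<alpha> s1) s2 A < 1"
      using SUP_lessD[OF assms(13), of s1] s1 s by (auto simp: s2_def)
    moreover have low1: "delay_low T \<alpha> s1 \<in> T" "delay_low T \<alpha> s1 \<le> s1" "c \<le> delay_low T \<alpha> s1"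
      using D.delay_low_in_T[of s1] D.delay_low_le_self[of s1] low_ge[of s1] s1 s by auto
    ultimately have "integral {delay_low T \<alpha> s1..s2} W.rate < 1"
      using W.delta_integral_eq_integral[OF adm low1(1) s2(1)] s2 by (simp add: W.rate_def[abs_def])
    moreover have "integral {s1..s2} W.rate \<le> integral {delay_low T \<alpha> s1..s2} W.rate"
      using low1 W.rate_nonneg locally_bounded_borel_integrable_on[OF W.rate_lb]
      by (intro integral_subset_le) auto
    moreover have "integral {s..s1} W.rate + integral {s1..s2} W.rate = integral {s..s2} W.rate"
      using s1 s2 by (intro Henstock_Kurzweil_Integration.integral_combine locally_bounded_borel_integrable_on W.rate_lb) auto
    ultimately have D: "integral {s..s2} W.rate \<le> B + 1" using 1 by linarith
    let ?N = "\<bar>x0\<bar> + history_norm T \<alpha> s \<phi>"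
    have "\<bar>x t\<bar> \<le> exp (2 * (B + 1)) * ?N * (W.decay t / W.decay s)"
      using s1 s2 by (intro W.solution_decay[OF s init sol s2(1) _ low D t]) auto
    also have "W.decay t / W.decay s = ts_exp T (ominus T (\<lambda>r. lam0 * A r)) t s"
      using W.ts_exp_ominus_rate[OF s(1) t(1)] s t c by simp
    also have "exp (2 * (B + 1)) * ?N * \<dots> \<le> exp (2 * (B + 1)) * ?N * (M1 * ts_exp T (ominus T (\<lambda>_. lam1)) t s)"
      using exp_bound[OF t(1) s(1) s(2) t(2)] history_norm_nonneg[OF init] by (intro mult_left_mono) auto
    finally show ?thesis by (simp add: mult_ac)
  qed
  have "0 < exp (2 * (B + 1)) * M1" using M1 by simp
  then show ?thesis
    unfolding uniformly_exponentially_stable_def using main M1(2) by (metis Int_iff atLeast_iff)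
qed

end
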